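(* Let $X$ be an arithmetically Cohen-Macaulay projective subscheme of $\mathbb{P}_n$ of pure dimension $m$, with characteristic sequence $(m_i)_{0\le i\le d-1}$, and let $l_i:=\operatorname{card}\{j : m_j=i\}$. Then the sequence $(l_i)_{i\ge 0}$ is a $0$-sequence.
   Context: $k$ is an algebraically closed field of characteristic $0$, $A_n=k[X_0,\dots,X_n]$. A projective subscheme $X\subset\mathbb{P}_n$ is given by its saturated homogeneous ideal $I_X$; $A_X=A_n/I_X$ and $\phi_X(l)=\dim_k A_X(l)$. $B[a](l)=B(a+l)$ denotes the shift of a graded module. $X$ of dimension $m$ is arithmetically Cohen-Macaulay (ACM) if $A_X$ admits a regular sequence of $m+1$ homogeneous polynomials. Characteristic sequence: if $X$ is nonempty ACM of pure dimension $m$ and degree $d$, and $Y_0,\dots,Y_m$ are linear forms forming a regular sequence for $A_X$, then with $R_m=k[Y_0,\dots,Y_m]$ one has $A_X\simeq\bigoplus_{i=0}^{d-1}R_m[-m_i]$ as graded $R_m$-modules with $0=m_0\le\dots\le m_{d-1}$; the sequence $(m_i)$ depends only on $\phi_X$. $0$-sequences: for integers $c>0$ and $e\ge1$, the $e$-th Macaulay representation of $c$ is the unique expression $c=\binom{k_e}{e}+\binom{k_{e-1}}{e-1}+\dots+\binom{k_\delta}{\delta}$ with $k_e>k_{e-1}>\dots>k_\delta\ge\delta>0$; put $c^{\langle e\rangle}:=\binom{k_e+1}{e+1}+\binom{k_{e-1}+1}{e}+\dots+\binom{k_\delta+1}{\delta+1}$, and $0^{\langle e\rangle}:=0$. A sequence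 $(a_l)_{l\ge0}$ of nonnegative integers is a $0$-sequence if $a_{l+1}\le a_l^{\langle l\rangle}$ for all $l\ge1$. *)

theory Defs
  imports
    Complex_Main
    "HOL-Library.Poly_Mapping"
    "HOL-Library.FuncSet"
    "HOL-Computational_Algebra.Polynomial"
    "HOL-Algebra.QuotRing"
    "HOL-Algebra.Generated_Rings"
    "HOL-Algebra.Embedded_Algebras"
begin

section \<open>The polynomial ring in the variables 0, ..., n and its grading\<close>

text \<open>A monomial is its exponent vector; a polynomial is a finitely supported
  coefficient function on monomials.\<close>

type_synonym mono = "nat \<Rightarrow>\<^sub>0 nat"
type_synonym 'k mpoly = "mono \<Rightarrow>\<^sub>0 'k"

definition mono_deg :: "mono \<Rightarrow> nat" where
  "mono_deg t = (\<Sum>i\<in>Poly_Mapping.keys t. Poly_Mapping.lookup t i)"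

definition poly_ring :: "nat \<Rightarrow> ('k::field) mpoly ring" where
  "poly_ring n =
    \<lparr>carrier = {p. \<forall>t\<in>Poly_Mapping.keys p. Poly_Mapping.keys t \<subseteq> {..n}},
     mult = (*), one = 1, zero = 0, add = (+)\<rparr>"

text \<open>Degrees are integers, so that shifts in both directions make sense;
  the component of negative degree is zero.\<close>

definition poly_comp :: "nat \<Rightarrow> int \<Rightarrow> ('k::field) mpoly set" where
  "poly_comp n l = {p \<in> carrier (poly_ring n). \<forall>t\<in>Poly_Mapping.keys p. int (mono_deg t) = l}"

definition constants :: "('k::field) mpoly set" where
  "constants = range (Poly_Mapping.single 0)"

definition homogeneous_ideal :: "nat \<Rightarrow> ('k::field) mpoly set \<Rightarrow> bool" where
  "homogeneous_ideal n I \<longleftrightarrow> ideal I (poly_ring n) \<and>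
     I = Idl\<^bsub>poly_ring n\<^esub> (I \<inter> (\<Union>l. poly_comp n l))"

text \<open>Saturation with respect to the ideal generated by all variables:
  \<open>p\<close> lies in \<open>I\<close> as soon as some power of that ideal multiplies \<open>p\<close> into \<open>I\<close>.\<close>

definition saturated_ideal :: "nat \<Rightarrow> ('k::field) mpoly set \<Rightarrow> bool" where
  "saturated_ideal n I \<longleftrightarrow>
     (\<forall>p\<in>carrier (poly_ring n).
        (\<exists>N::nat. \<forall>q\<in>poly_comp n (int N). q * p \<in> I) \<longrightarrow> p \<in> I)"

text \<open>A closed subscheme of projective \<open>n\<close>-space is identified with its saturated
  homogeneous ideal.\<close>

definition projective_subscheme :: "nat \<Rightarrow> ('k::field) mpoly set \<Rightarrow> bool" where
  "projective_subscheme n I \<longleftrightarrow> homogeneous_ideal n I \<and> saturated_ideal n I"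

section \<open>Dimension\<close>

text \<open>The points of \<open>Proj\<close> of the homogeneous coordinate ring: the homogeneous primes over \<open>I\<close>
  not containing all linear forms. Inclusion of primes reverses inclusion of the corresponding
  irreducible closed subsets.\<close>

definition points :: "nat \<Rightarrow> ('k::field) mpoly set \<Rightarrow> 'k mpoly set set" where
  "points n I = {P. primeideal P (poly_ring n) \<and> homogeneous_ideal n P \<and> I \<subseteq> P \<and>
     \<not> poly_comp n 1 \<subseteq> P}"

definition point_chain ::
  "nat \<Rightarrow> ('k::field) mpoly set \<Rightarrow> nat \<Rightarrow> (nat \<Rightarrow> 'k mpoly set) \<Rightarrow> bool" where
  "point_chain n I r P \<longleftrightarrow> (\<forall>i\<le>r. P i \<in> points n I) \<and> (\<forall>i<r. P i \<subset> P (Suc i))"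

text \<open>The empty scheme has no dimension in this sense.\<close>

definition has_dim :: "nat \<Rightarrow> ('k::field) mpoly set \<Rightarrow> nat \<Rightarrow> bool" where
  "has_dim n I m \<longleftrightarrow> (\<exists>P. point_chain n I m P) \<and> (\<forall>r P. point_chain n I r P \<longrightarrow> r \<le> m)"

text \<open>The irreducible components correspond to the minimal points.\<close>

definition pure_dim :: "nat \<Rightarrow> ('k::field) mpoly set \<Rightarrow> nat \<Rightarrow> bool" where
  "pure_dim n I m \<longleftrightarrow> points n I \<noteq> {} \<and>
     (\<forall>P\<in>points n I. (\<forall>Q\<in>points n I. Q \<subseteq> P \<longrightarrow> Q = P) \<longrightarrow> has_dim n P m)"

section \<open>The homogeneous coordinate ring, Hilbert function and degree\<close>

definition coord_ring :: "nat \<Rightarrow> ('k::field) mpoly set \<Rightarrow> 'k mpoly set ring" where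
  "coord_ring n I = poly_ring n Quot I"

definition residue_class ::
  "nat \<Rightarrow> ('k::field) mpoly set \<Rightarrow> 'k mpoly \<Rightarrow> 'k mpoly set" where
  "residue_class n I p = I +>\<^bsub>poly_ring n\<^esub> p"

definition coord_comp :: "nat \<Rightarrow> ('k::field) mpoly set \<Rightarrow> int \<Rightarrow> 'k mpoly set set" where
  "coord_comp n I l = residue_class n I ` poly_comp n l"

text \<open>The ground field acts on the coordinate ring through the residue classes of the constants.\<close>

definition hilbert_fun :: "nat \<Rightarrow> ('k::field) mpoly set \<Rightarrow> nat \<Rightarrow> nat" where
  "hilbert_fun n I l =
     ring.dim (coord_ring n I) (residue_class n I ` constants) (coord_comp n I (int l))"

text \<open>The degree is the leading coefficient of the Hilbert polynomial,
  multiplied by the factorial of the degree of that polynomial.\<close>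

definition has_degree :: "nat \<Rightarrow> ('k::field) mpoly set \<Rightarrow> nat \<Rightarrow> bool" where
  "has_degree n I d \<longleftrightarrow>
     (\<exists>H :: real poly.
        (\<forall>\<^sub>F l in sequentially. real (hilbert_fun n I l) = poly H (real l)) \<and>
        real d = fact (Polynomial.degree H) * lead_coeff H)"

section \<open>Regular sequences and the arithmetically Cohen-Macaulay property\<close>

definition regular_sequence :: "('a, 'b) ring_scheme \<Rightarrow> 'a list \<Rightarrow> bool" where
  "regular_sequence R fs \<longleftrightarrow> set fs \<subseteq> carrier R \<and>
     (\<forall>i<length fs. \<forall>x\<in>carrier R.
        fs ! i \<otimes>\<^bsub>R\<^esub> x \<in> Idl\<^bsub>R\<^esub> (set (take i fs)) \<longrightarrow> x \<in> Idl\<^bsub>R\<^esub> (set (take i fs))) \<and>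
     Idl\<^bsub>R\<^esub> (set fs) \<noteq> carrier R"

definition arith_CM :: "nat \<Rightarrow> ('k::field) mpoly set \<Rightarrow> bool" where
  "arith_CM n I \<longleftrightarrow>
     (\<exists>m fs. has_dim n I m \<and> length fs = Suc m \<and> set fs \<subseteq> (\<Union>l. poly_comp n l) \<and>
        regular_sequence (coord_ring n I) (map (residue_class n I) fs))"

section \<open>Graded modules\<close>

record ('a, 'b) graded_module = "('a, 'b) module" +
  grade :: "int \<Rightarrow> 'b set"

definition shift :: "int \<Rightarrow> ('a, 'b) graded_module \<Rightarrow> ('a, 'b) graded_module" where
  "shift a M = M\<lparr>grade := \<lambda>l. grade M (a + l)\<rparr>"

text \<open>For a finite index set, where product and direct sum coincide.
  The ring fields \<open>mult\<close> and \<open>one\<close> play no role in a module.\<close>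

definition direct_sum ::
  "'i set \<Rightarrow> ('i \<Rightarrow> ('a, 'b) graded_module) \<Rightarrow> ('a, 'i \<Rightarrow> 'b) graded_module" where
  "direct_sum J M =
    \<lparr>carrier = (\<Pi>\<^sub>E i\<in>J. carrier (M i)),
     mult = (\<lambda>x y. \<lambda>i\<in>J. x i \<otimes>\<^bsub>M i\<^esub> y i),
     one = (\<lambda>i\<in>J. \<one>\<^bsub>M i\<^esub>),
     zero = (\<lambda>i\<in>J. \<zero>\<^bsub>M i\<^esub>),
     add = (\<lambda>x y. \<lambda>i\<in>J. x i \<oplus>\<^bsub>M i\<^esub> y i),
     smult = (\<lambda>r x. \<lambda>i\<in>J. r \<odot>\<^bsub>M i\<^esub> x i),
     grade = (\<lambda>l. \<Pi>\<^sub>E i\<in>J. grade (M i) l)\<rparr>"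

definition graded_iso ::
  "('a, 'r) ring_scheme \<Rightarrow> ('a, 'b) graded_module \<Rightarrow> ('a, 'c) graded_module \<Rightarrow> ('b \<Rightarrow> 'c) \<Rightarrow> bool"
  where
  "graded_iso R M N f \<longleftrightarrow>
     bij_betw f (carrier M) (carrier N) \<and>
     (\<forall>x\<in>carrier M. \<forall>y\<in>carrier M. f (x \<oplus>\<^bsub>M\<^esub> y) = f x \<oplus>\<^bsub>N\<^esub> f y) \<and>
     (\<forall>r\<in>carrier R. \<forall>x\<in>carrier M. f (r \<odot>\<^bsub>M\<^esub> x) = r \<odot>\<^bsub>N\<^esub> f x) \<and>
     (\<forall>l. f ` grade M l = grade N l)"

section \<open>The characteristic sequence\<close>

text \<open>The ring \<open>k[Y\<^sub>0, \<dots>, Y\<^sub>m]\<close>, as a graded subalgebra of the polynomial ring. If the linear forms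
  \<open>Y\<^sub>i\<close> are a regular sequence for some coordinate ring, they are linearly independent, so this is
  a polynomial ring with its standard grading.\<close>

definition param_ring :: "nat \<Rightarrow> ('k::field) mpoly list \<Rightarrow> 'k mpoly ring" where
  "param_ring n Ys =
     (poly_ring n)\<lparr>carrier := generate_ring (poly_ring n) (constants \<union> set Ys)\<rparr>"

definition param_module ::
  "nat \<Rightarrow> ('k::field) mpoly list \<Rightarrow> ('k mpoly, 'k mpoly) graded_module" where
  "param_module n Ys =
    \<lparr>carrier = carrier (param_ring n Ys), mult = (*), one = 1, zero = 0, add = (+),
     smult = (*), grade = (\<lambda>l. carrier (param_ring n Ys) \<inter> poly_comp n l)\<rparr>"

definition coord_module ::
  "nat \<Rightarrow> ('k::field) mpoly set \<Rightarrow> ('k mpoly, 'k mpoly set) graded_module" where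
  "coord_module n I =
    \<lparr>carrier = carrier (coord_ring n I), mult = mult (coord_ring n I),
     one = one (coord_ring n I), zero = zero (coord_ring n I), add = add (coord_ring n I),
     smult = (\<lambda>r x. residue_class n I r \<otimes>\<^bsub>coord_ring n I\<^esub> x),
     grade = coord_comp n I\<rparr>"

definition characteristic_sequence ::
  "nat \<Rightarrow> ('k::field) mpoly set \<Rightarrow> nat \<Rightarrow> nat \<Rightarrow> (nat \<Rightarrow> nat) \<Rightarrow> bool" where
  "characteristic_sequence n I m d ms \<longleftrightarrow>
     0 < d \<and> ms 0 = 0 \<and> mono_on {..<d} ms \<and>
     (\<exists>Ys f. length Ys = Suc m \<and> set Ys \<subseteq> poly_comp n 1 \<and>
        regular_sequence (coord_ring n I) (map (residue_class n I) Ys) \<and>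
        graded_iso (param_ring n Ys)
          (direct_sum {..<d} (\<lambda>i. shift (- int (ms i)) (param_module n Ys)))
          (coord_module n I) f)"

section \<open>0-sequences\<close>

text \<open>\<open>c = (k\<^sub>e choose e) + \<dots> + (k\<^sub>\<delta> choose \<delta>)\<close> with \<open>k\<^sub>e > \<dots> > k\<^sub>\<delta> \<ge> \<delta> > 0\<close>;
  only the values of \<open>k\<close> on \<open>{\<delta>..e}\<close> matter.\<close>

definition macaulay_rep :: "nat \<Rightarrow> nat \<Rightarrow> nat \<Rightarrow> (nat \<Rightarrow> nat) \<Rightarrow> bool" where
  "macaulay_rep e c \<delta> k \<longleftrightarrow>
     0 < \<delta> \<and> \<delta> \<le> e \<and> \<delta> \<le> k \<delta> \<and> (\<forall>j\<in>{\<delta>..<e}. k j < k (Suc j)) \<and>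
     c = (\<Sum>j=\<delta>..e. k j choose j)"

definition macaulay_up :: "nat \<Rightarrow> nat \<Rightarrow> nat" where
  "macaulay_up e c =
     (if c = 0 then 0
      else THE u. \<exists>\<delta> k. macaulay_rep e c \<delta> k \<and> u = (\<Sum>j=\<delta>..e. Suc (k j) choose Suc j))"

definition zero_sequence :: "(nat \<Rightarrow> nat) \<Rightarrow> bool" where
  "zero_sequence a \<longleftrightarrow> (\<forall>l\<ge>1. a (Suc l) \<le> macaulay_up l (a l))"

end

theory Submission
  imports Defs "HOL-Library.Function_Algebras"
begin

text \<open>The isomorphism \<open>f\<close> gives every \<open>p\<close> in the polynomial ring coordinates in the parameter ring
  \<open>R\<close>; let \<open>\<phi> p\<close> be the vector of their constant terms. On degree \<open>l\<close> the image of \<open>\<phi>\<close> has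
  dimension \<open>card {j. ms j = l}\<close>, and the kernel of \<open>\<phi>\<close> is stable under multiplication by
  polynomials, because these act \<open>R\<close>-linearly and taking constant terms is multiplicative. Hence the
  numbers in question count the standard monomials, those \<open>t\<close> for which \<open>\<phi> t\<close> is not in the span of
  the values at smaller monomials, and the standard monomials are closed under divisors.

  It remains to prove Macaulay's bound for sets \<open>S\<close>, \<open>T\<close> of monomials in degrees \<open>d\<close> and \<open>d + 1\<close> such
  that \<open>S\<close> contains the divisors of \<open>T\<close>. Replacing the fibres in two variables by initial segments
  preserves the cardinalities and this condition; when it is no longer possible the sets are strongly
  stable. For these, Macaulay's bound follows together with Green's bound on the monomials not
  divisible by the last variable, by induction on the number of variables.\<close>

section \<open>Macaulay representations\<close>

text \<open>The Macaulay representation with index shifted by one and padded to full length by \<open>k j = j\<close>,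
  so that \<open>0\<close> is represented as well.\<close>

definition cascade :: "nat \<Rightarrow> (nat \<Rightarrow> nat) \<Rightarrow> bool" where
  "cascade e k \<longleftrightarrow> (\<forall>j. Suc j < e \<longrightarrow> k j < k (Suc j))"

definition cascade_sum :: "nat \<Rightarrow> (nat \<Rightarrow> nat) \<Rightarrow> nat" where
  "cascade_sum e k = (\<Sum>j<e. k j choose Suc j)"

definition cascade_up :: "nat \<Rightarrow> (nat \<Rightarrow> nat) \<Rightarrow> nat" where
  "cascade_up e k = (\<Sum>j<e. Suc (k j) choose Suc (Suc j))"

text \<open>Green's operator: it will bound the monomials of a set not divisible by the last
  variable, as \<open>cascade_up\<close> bounds the growth in degree.\<close>

definition cascade_down :: "nat \<Rightarrow> (nat \<Rightarrow> nat) \<Rightarrow> nat" where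
  "cascade_down e k = (\<Sum>j<e. (k j - 1) choose Suc j)"

section \<open>Existence and uniqueness of cascades\<close>

lemma cascade_ge: "cascade e k \<Longrightarrow> j < e \<Longrightarrow> j \<le> k j"
proof (induction j)
  case (Suc j)
  then show ?case unfolding cascade_def by (metis Suc_leI Suc_lessD le_less_trans)
qed simp

lemma cascade_less:
  assumes "cascade e k"
  shows "i < j \<Longrightarrow> j < e \<Longrightarrow> k i < k j"
proof (induction j)
  case (Suc j)
  then show ?case
    using assms unfolding cascade_def by (metis Suc_lessD less_Suc_eq less_trans)
qed simp

lemma cascade_SucD: "cascade (Suc e) k \<Longrightarrow> cascade e k"
  by (simp add: cascade_def)

text \<open>By induction the terms below the top stay under \<open>k e choose e\<close>; Pascal's
  rule then bounds the whole sum by \<open>Suc (k e) choose Suc e\<close>.\<close>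

lemma cascade_sum_less:
  "cascade e k \<Longrightarrow> (\<And>j. j < e \<Longrightarrow> k j < K) \<Longrightarrow> cascade_sum e k < K choose e"
proof (induction e arbitrary: K)
  case (Suc e)
  have *: "k j < k e" if "j < e" for j
    using cascade_less[OF Suc.prems(1) that] by simp
  have "cascade_sum e k < k e choose e"
    using Suc.IH[of "k e"] Suc.prems(1) * cascade_SucD by blast
  then have "cascade_sum (Suc e) k < Suc (k e) choose Suc e"
    by (simp add: cascade_sum_def)
  also have "\<dots> \<le> K choose Suc e"
    using Suc.prems(2)[of e] by (intro binomial_right_mono) auto
  finally show ?case .
qed (simp add: cascade_sum_def)

lemma cascade_sum_less_top:
  assumes "cascade (Suc e) k"
  shows "cascade_sum (Suc e) k < Suc (k e) choose Suc e"
proof (rule cascade_sum_less[OF assms])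
  fix j assume "j < Suc e"
  then show "k j < Suc (k e)"
    using cascade_less[OF assms, of j e] by (cases "j = e") auto
qed

lemma cascade_exists:
  "c < K choose e \<Longrightarrow> \<exists>k. cascade e k \<and> (\<forall>j<e. k j < K) \<and> cascade_sum e k = c"
proof (induction e arbitrary: K c)
  case (Suc e)
  \<comment> \<open>Greedy choice of the top entry. Maximality and Pascal's rule leave a remainder
    below \<open>p choose e\<close>, so the induction hypothesis yields entries below
    \<open>p\<close>.\<close>
  define p where "p = (GREATEST p. p choose Suc e \<le> c)"
  have bound: "y < K" if "y choose Suc e \<le> c" for y
    using that Suc.prems binomial_right_mono[of K y "Suc e"] by (meson leD leI le_trans less_le_trans)
  have p: "p choose Suc e \<le> c"
    unfolding p_def by (rule GreatestI_nat[where b = K and k = 0]) (auto dest: bound)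
  have "\<not> Suc p choose Suc e \<le> c"
    using Greatest_le_nat[where P = "\<lambda>p. p choose Suc e \<le> c" and b = K and k = "Suc p"] bound
    by (auto simp: p_def[symmetric] simp del: binomial_Suc_Suc dest: less_imp_le)
  then have "c - (p choose Suc e) < p choose e"
    using p by simp
  then obtain k where k: "cascade e k" "\<forall>j<e. k j < p" "cascade_sum e k = c - (p choose Suc e)"
    using Suc.IH by blast
  define k' where "k' = k(e := p)"
  have "cascade_sum e k' = cascade_sum e k"
    by (simp add: cascade_sum_def k'_def)
  then have "cascade_sum (Suc e) k' = c"
    using k(3) p by (simp add: cascade_sum_def k'_def)
  moreover have "cascade (Suc e) k'"
    using k(1,2) by (auto simp: cascade_def k'_def)
  moreover have "\<forall>j<Suc e. k' j < K"
    using k(2) bound[OF p] by (auto simp: k'_def less_Suc_eq intro: less_trans)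
  ultimately show ?case by blast
qed (auto simp: cascade_def cascade_sum_def)

text \<open>By \<open>cascade_sum_less_top\<close> the lower terms cannot make up for a smaller top
  entry. Hence the top entries agree, and induction treats the rest.\<close>

lemma cascade_unique:
  "cascade e k \<Longrightarrow> cascade e k' \<Longrightarrow> cascade_sum e k = cascade_sum e k' \<Longrightarrow> j < e \<Longrightarrow> k j = k' j"
proof (induction e arbitrary: j)
  case (Suc e)
  have False if "cascade (Suc e) a" "cascade (Suc e) b" "cascade_sum (Suc e) a = cascade_sum (Suc e) b"
    "a e < b e" for a b
  proof -
    have "cascade_sum (Suc e) a < Suc (a e) choose Suc e"
      by (rule cascade_sum_less_top) fact
    also have "\<dots> \<le> b e choose Suc e"
      using that(4) by (intro binomial_right_mono) auto
    also have "\<dots> \<le> cascade_sum (Suc e) b"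
      by (simp add: cascade_sum_def)
    finally show False using that(3) by simp
  qed
  then have e: "k e = k' e"
    using Suc.prems by (metis linorder_neqE_nat)
  then have "cascade_sum e k = cascade_sum e k'"
    using Suc.prems(3) by (simp add: cascade_sum_def)
  then show ?case
    using Suc e by (metis cascade_SucD less_Suc_eq)
qed simp

text \<open>Translates between the zero-based sums of cascades and the sums of
  \<open>macaulay_rep\<close>, which are one-based and start at \<open>\<delta>\<close>.\<close>

lemma sum_rep_shift:
  fixes g :: "nat \<Rightarrow> nat"
  assumes "0 < \<delta>" "\<And>j. Suc j < \<delta> \<Longrightarrow> g j = 0"
  shows "(\<Sum>j<e. g j) = (\<Sum>j=\<delta>..e. g (j - 1))"
proof -
  have "(\<Sum>j<e. g j) = (\<Sum>j=Suc 0..e. g (j - 1))"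
    by (rule sum.reindex_bij_witness[where i = "\<lambda>j. j - 1" and j = Suc]) auto
  also have "\<dots> = (\<Sum>j=\<delta>..e. g (j - 1))"
    using assms by (intro sum.mono_neutral_right) auto
  finally show ?thesis .
qed

text \<open>Padding with \<open>k j = j\<close> below \<open>\<delta>\<close> adds only vanishing binomial coefficients.\<close>

lemma macaulay_rep_imp_cascade:
  assumes "macaulay_rep e c \<delta> k"
  shows "\<exists>k'. cascade e k' \<and> cascade_sum e k' = c \<and>
    cascade_up e k' = (\<Sum>j=\<delta>..e. Suc (k j) choose Suc j)"
proof -
  note r = assms[unfolded macaulay_rep_def]
  define k' where "k' = (\<lambda>j. if Suc j < \<delta> then j else k (Suc j))"
  have "cascade e k'"
    unfolding cascade_def
  proof (intro allI impI)
    fix j assume "Suc j < e"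
    then show "k' j < k' (Suc j)"
      using r by (cases "Suc (Suc j) = \<delta>") (auto simp: k'_def)
  qed
  moreover have "cascade_sum e k' = (\<Sum>j=\<delta>..e. k' (j - 1) choose Suc (j - 1))"
    unfolding cascade_sum_def using r by (intro sum_rep_shift) (auto simp: k'_def)
  moreover have "cascade_up e k' = (\<Sum>j=\<delta>..e. Suc (k' (j - 1)) choose Suc (Suc (j - 1)))"
    unfolding cascade_up_def using r by (intro sum_rep_shift) (auto simp: k'_def)
  moreover have "k' (j - 1) = k j" "Suc (j - 1) = j" if "j \<in> {\<delta>..e}" for j
    using that r by (auto simp: k'_def)
  ultimately show ?thesis using r by (intro exI[of _ k']) simp
qed

lemma cascade_imp_macaulay_rep:
  assumes "cascade e k" "cascade_sum e k > 0"
  shows "\<exists>\<delta> k'. macaulay_rep e (cascade_sum e k) \<delta> k' \<and>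
    cascade_up e k = (\<Sum>j=\<delta>..e. Suc (k' j) choose Suc j)"
proof -
  have "\<exists>j<e. j < k j"
  proof (rule ccontr)
    assume "\<not> (\<exists>j<e. j < k j)"
    then have "cascade_sum e k = 0"
      by (auto simp: cascade_sum_def less_Suc_eq_le)
    with assms(2) show False by simp
  qed
  \<comment> \<open>The first strict inequality gives \<open>\<delta> = Suc j0\<close>; before it
    \<open>k j = j\<close>, so those binomial coefficients vanish.\<close>
  then obtain j0 where j0: "j0 < e" "j0 < k j0" "\<And>j. j < j0 \<Longrightarrow> \<not> j < k j"
    using exists_least_iff[of "\<lambda>j. j < e \<and> j < k j"] by auto
  have low: "k j = j" if "j < j0" for j
    using cascade_ge[OF assms(1), of j] j0(1) j0(3)[OF that] that by simp
  define k' where "k' = (\<lambda>j. k (j - 1))"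
  have 1: "cascade_sum e k = (\<Sum>j=Suc j0..e. k (j - 1) choose Suc (j - 1))"
    unfolding cascade_sum_def by (intro sum_rep_shift) (auto simp: low)
  have 2: "cascade_up e k = (\<Sum>j=Suc j0..e. Suc (k (j - 1)) choose Suc (Suc (j - 1)))"
    unfolding cascade_up_def by (intro sum_rep_shift) (auto simp: low)
  have "k' j < k' (Suc j)" if "j \<in> {Suc j0..<e}" for j
  proof -
    have "Suc (j - 1) < e" "Suc (j - 1) = j" using that by auto
    then show ?thesis using assms(1) unfolding cascade_def k'_def by (metis diff_Suc_1)
  qed
  then have "macaulay_rep e (cascade_sum e k) (Suc j0) k'"
    unfolding macaulay_rep_def using j0(1,2) by (subst 1) (auto simp: k'_def intro!: sum.cong)
  moreover have "cascade_up e k = (\<Sum>j=Suc j0..e. Suc (k' j) choose Suc j)"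
    unfolding 2 by (intro sum.cong) (auto simp: k'_def)
  ultimately show ?thesis by blast
qed

text \<open>Uniqueness of cascades makes the definite description independent of the chosen
  representation. For sum 0 every term of \<open>cascade_up\<close> vanishes too, in agreement with
  the convention there.\<close>

lemma macaulay_up_cascade_sum:
  assumes "cascade e k"
  shows "macaulay_up e (cascade_sum e k) = cascade_up e k"
proof (cases "cascade_sum e k = 0")
  case True
  then have "\<forall>j<e. k j < Suc j"
    by (auto simp: cascade_sum_def)
  then have "cascade_up e k = 0"
    by (auto simp: cascade_up_def less_SucI simp del: binomial_Suc_Suc)
  with True show ?thesis by (simp add: macaulay_up_def)
next
  case False
  have "(THE u. \<exists>\<delta> k'. macaulay_rep e (cascade_sum e k) \<delta> k' \<and>
      u = (\<Sum>j=\<delta>..e. Suc (k' j) choose Suc j)) = cascade_up e k"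
  proof (rule the_equality)
    show "\<exists>\<delta> k'. macaulay_rep e (cascade_sum e k) \<delta> k' \<and>
        cascade_up e k = (\<Sum>j=\<delta>..e. Suc (k' j) choose Suc j)"
      using cascade_imp_macaulay_rep[OF assms] False by simp
  next
    fix u
    assume "\<exists>\<delta> k'. macaulay_rep e (cascade_sum e k) \<delta> k' \<and>
      u = (\<Sum>j=\<delta>..e. Suc (k' j) choose Suc j)"
    then obtain k' where k': "cascade e k'" "cascade_sum e k' = cascade_sum e k" "u = cascade_up e k'"
      using macaulay_rep_imp_cascade by metis
    then have "k' j = k j" if "j < e" for j
      using cascade_unique assms that by blast
    then show "u = cascade_up e k"
      by (simp add: k'(3) cascade_up_def)
  qed
  with False show ?thesis by (simp add: macaulay_up_def)
qed

lemma cascade_sum_surj: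
  assumes "1 \<le> e"
  obtains k where "cascade e k" "cascade_sum e k = c"
proof -
  have "c < (c + e) choose e"
  proof (cases e)
    case (Suc e')
    have "Suc c \<le> (c + e) choose e"
      unfolding Suc
    proof (induction c)
      case (Suc c)
      have "1 \<le> (c + Suc e') choose e'" by (simp add: Suc_le_eq)
      then show ?case using Suc by simp
    qed simp
    then show ?thesis by simp
  qed (use assms in simp)
  then show ?thesis using cascade_exists that by blast
qed

text \<open>The truncated differences \<open>k j - 1\<close> increase strictly except possibly at the bottom, where
  \<open>k j = j\<close>; there the binomial coefficients vanish and \<open>j\<close> can be kept.\<close>

lemma cascade_down_cascade:
  assumes "cascade e k"
  obtains k' where "cascade e k'" "cascade_sum e k' = cascade_down e k"
    "cascade_up e k' = (\<Sum>j<e. k j choose Suc (Suc j))"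
proof
  define k' where "k' = (\<lambda>j. max (k j - 1) j)"
  show "cascade e k'"
    unfolding cascade_def
  proof (intro allI impI)
    fix j assume "Suc j < e"
    then have "k j < k (Suc j)" "j \<le> k j"
      using assms cascade_ge[OF assms, of j] by (auto simp: cascade_def)
    then show "k' j < k' (Suc j)" by (auto simp: k'_def)
  qed
  show "cascade_sum e k' = cascade_down e k"
    unfolding cascade_sum_def cascade_down_def by (intro sum.cong) (auto simp: k'_def max_def binomial_eq_0)
  have "Suc (k' j) choose Suc (Suc j) = k j choose Suc (Suc j)" if "j < e" for j
  proof (cases "k j = j")
    case True
    then show ?thesis by (simp add: k'_def max_def)
  next
    case False
    then have "j < k j" using cascade_ge[OF assms that] by simp
    then have "k' j = k j - 1" "Suc (k j - 1) = k j" by (auto simp: k'_def max_def)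
    then show ?thesis by simp
  qed
  then show "cascade_up e k' = (\<Sum>j<e. k j choose Suc (Suc j))"
    by (simp add: cascade_up_def)
qed

lemma cascade_up_split:
  "cascade_up e k = cascade_sum e k + (\<Sum>j<e. k j choose Suc (Suc j))"
  by (simp add: cascade_up_def cascade_sum_def sum.distrib)

text \<open>Pascal's rule splits each term above the bottom one into a term of
  \<open>cascade_down\<close> and a term of the tail cascade; the bottom terms differ by at most 1,
  whence the \<open>Suc\<close>. These estimates drive the induction on the degree in Green's
  bound.\<close>

lemma cascade_tail:
  assumes "cascade (Suc e) k"
  shows "cascade e (\<lambda>j. k (Suc j) - 1)"
    and "cascade_sum (Suc e) k \<le> Suc (cascade_down (Suc e) k + cascade_sum e (\<lambda>j. k (Suc j) - 1))"
    and "(\<Sum>j<e. (k (Suc j) - 1) choose Suc (Suc j)) \<le> cascade_down (Suc e) k"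
proof -
  show "cascade e (\<lambda>j. k (Suc j) - 1)"
    unfolding cascade_def
  proof (intro allI impI)
    fix j assume "Suc j < e"
    then have "k j < k (Suc j)" "k (Suc j) < k (Suc (Suc j))"
      using assms by (auto simp: cascade_def)
    then show "k (Suc j) - 1 < k (Suc (Suc j)) - 1" by simp
  qed
  have "k (Suc j) choose Suc (Suc j) =
      ((k (Suc j) - 1) choose Suc (Suc j)) + ((k (Suc j) - 1) choose Suc j)" if "j < e" for j
  proof -
    have "k (Suc j) \<noteq> 0" using assms that by (auto simp: cascade_def)
    then obtain p where "k (Suc j) = Suc p" using not0_implies_Suc by blast
    then show ?thesis by simp
  qed
  then have "(\<Sum>j<e. k (Suc j) choose Suc (Suc j)) =
      (\<Sum>j<e. (k (Suc j) - 1) choose Suc (Suc j)) + cascade_sum e (\<lambda>j. k (Suc j) - 1)"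
    by (simp add: cascade_sum_def sum.distrib)
  then show "cascade_sum (Suc e) k \<le>
      Suc (cascade_down (Suc e) k + cascade_sum e (\<lambda>j. k (Suc j) - 1))"
    unfolding cascade_sum_def[of "Suc e"] cascade_down_def sum.lessThan_Suc_shift by simp
  show "(\<Sum>j<e. (k (Suc j) - 1) choose Suc (Suc j)) \<le> cascade_down (Suc e) k"
    unfolding cascade_down_def sum.lessThan_Suc_shift by simp
qed

section \<open>Strongly stable sets of monomials\<close>

abbreviation var :: "nat \<Rightarrow> mono" where
  "var i \<equiv> Poly_Mapping.single i (Suc 0)"

definition monomials :: "nat \<Rightarrow> nat \<Rightarrow> mono set" where
  "monomials v d = {t. Poly_Mapping.keys t \<subseteq> {..<v} \<and> mono_deg t = d}"

definition shadow_in :: "mono set \<Rightarrow> mono set \<Rightarrow> bool" where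
  "shadow_in T S \<longleftrightarrow> (\<forall>s i. s + var i \<in> T \<longrightarrow> s \<in> S)"

text \<open>Exchanges go to larger indices because such sets play the role of standard monomials:
  they are complements, in one degree, of strongly stable ideals, whose exchanges go to smaller
  indices.\<close>

definition strongly_stable :: "nat \<Rightarrow> mono set \<Rightarrow> bool" where
  "strongly_stable v N \<longleftrightarrow> (\<forall>s i j. i < j \<longrightarrow> j < v \<longrightarrow> s + var i \<in> N \<longrightarrow> s + var j \<in> N)"

section \<open>Degrees and supports of monomials\<close>

lemma mono_deg_eq:
  assumes "finite A" "Poly_Mapping.keys t \<subseteq> A"
  shows "mono_deg t = (\<Sum>i\<in>A. Poly_Mapping.lookup t i)"
  unfolding mono_deg_def using assms by (intro sum.mono_neutral_left) (auto simp: in_keys_iff)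

lemma keys_add_mono: "Poly_Mapping.keys (s + t) = Poly_Mapping.keys s \<union> Poly_Mapping.keys (t :: mono)"
  by (auto simp: in_keys_iff lookup_add)

lemma mono_deg_add: "mono_deg (s + t) = mono_deg s + mono_deg t"
  by (simp add: mono_deg_eq[of "Poly_Mapping.keys s \<union> Poly_Mapping.keys t"] keys_add_mono
      lookup_add sum.distrib)

lemma mono_deg_single [simp]: "mono_deg (Poly_Mapping.single i a) = a"
  by (simp add: mono_deg_eq[of "{i}"])

lemma mono_eq_add_var:
  assumes "Poly_Mapping.lookup t i \<noteq> 0"
  obtains s where "t = s + var i"
proof
  show "t = (t - var i) + var i"
    using assms by (intro poly_mapping_eqI) (auto simp: lookup_add lookup_minus lookup_single when_def)
qed

lemma monomials_add_var_iff: "s + var i \<in> monomials v d \<longleftrightarrow> i < v \<and> s \<in> monomials v (d - 1) \<and> 0 < d"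
  by (auto simp: monomials_def keys_add_mono mono_deg_add)

lemma finite_monomials [simp]: "finite (monomials v d)"
proof -
  have "Poly_Mapping.lookup t i \<le> d" if "t \<in> monomials v d" for t i
    using that member_le_sum[of i "Poly_Mapping.keys t" "Poly_Mapping.lookup t"]
    by (cases "i \<in> Poly_Mapping.keys t") (auto simp: monomials_def mono_deg_def in_keys_iff)
  then have "Poly_Mapping.lookup ` monomials v d \<subseteq>
      {f. \<forall>i. (i \<in> {..<v} \<longrightarrow> f i \<in> {..d}) \<and> (i \<notin> {..<v} \<longrightarrow> f i = 0)}"
    by (auto simp: monomials_def in_keys_iff subset_iff)
  then have "finite (Poly_Mapping.lookup ` monomials v d)"
    by (rule finite_subset) (intro finite_set_of_finite_funs; simp)
  then show ?thesis
    by (rule finite_imageD) (auto simp: inj_on_def intro: poly_mapping_eqI)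
qed

lemma monomials_restrict: "{t \<in> monomials (Suc v) d. Poly_Mapping.lookup t v = 0} = monomials v d"
  by (auto simp: monomials_def in_keys_iff subset_iff less_Suc_eq) (metis neq0_conv)

lemma card_split_last:
  assumes "N \<subseteq> monomials (Suc v) d"
  shows "card N = card {t \<in> N. Poly_Mapping.lookup t v = 0} + card {s. s + var v \<in> N}"
proof -
  have "N = {t \<in> N. Poly_Mapping.lookup t v = 0} \<union> (\<lambda>s. s + var v) ` {s. s + var v \<in> N}"
    using mono_eq_add_var by (auto simp: image_iff)
  moreover have "finite N" using assms finite_subset finite_monomials by blast
  moreover have "card ((\<lambda>s. s + var v) ` {s. s + var v \<in> N}) = card {s. s + var v \<in> N}"
    by (intro card_image) (auto simp: inj_on_def)
  moreover have "{t \<in> N. Poly_Mapping.lookup t v = 0} \<inter> (\<lambda>s. s + var v) ` {s. s + var v \<in> N} = {}"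
    by (auto simp: lookup_add)
  ultimately show ?thesis
    by (metis (no_types, lifting) card_Un_disjoint finite_Un)
qed

text \<open>A predicate of \<open>v\<close> alone, so that Green's bound with one more variable can
  call it in lower degrees. The size of \<open>S\<close> enters through an inequality because
  Green's bound supplies only an estimate.\<close>

definition macaulay_bound :: "nat \<Rightarrow> bool" where
  "macaulay_bound v \<longleftrightarrow> (\<forall>d k S T. cascade d k \<longrightarrow> S \<subseteq> monomials v d \<longrightarrow> T \<subseteq> monomials v (Suc d) \<longrightarrow>
     shadow_in T S \<longrightarrow> strongly_stable v S \<longrightarrow> strongly_stable v T \<longrightarrow>
     card S \<le> cascade_sum d k \<longrightarrow> card T \<le> cascade_up d k)"

lemma macaulay_boundD:
  assumes "macaulay_bound v" "cascade d k" "S \<subseteq> monomials v d" "T \<subseteq> monomials v (Suc d)"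
    "shadow_in T S" "strongly_stable v S" "strongly_stable v T" "card S \<le> cascade_sum d k"
  shows "card T \<le> cascade_up d k"
  using assms unfolding macaulay_bound_def by blast

lemma strongly_stable_restrict:
  assumes "strongly_stable (Suc v) N"
  shows "strongly_stable v {t \<in> N. Poly_Mapping.lookup t v = 0}"
  using assms unfolding strongly_stable_def by (auto simp: lookup_add lookup_single when_def)

text \<open>If the bound fails for the restriction \<open>R\<close> of \<open>N\<close> to the first \<open>v\<close> variables, then the colon
  \<open>C\<close> of \<open>N\<close> by the last variable is so small that its restriction, which contains the shadow
  of \<open>R\<close>, contradicts Macaulay's bound for \<open>R\<close>.\<close>

lemma green_bound:
  assumes M: "macaulay_bound v"
  shows "cascade d k \<Longrightarrow> N \<subseteq> monomials (Suc v) d \<Longrightarrow> strongly_stable (Suc v) N \<Longrightarrow>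
    card N \<le> cascade_sum d k \<Longrightarrow>
    card {t \<in> N. Poly_Mapping.lookup t v = 0} \<le> cascade_down d k"
proof (induction d arbitrary: N k)
  case 0
  then have "N = {}"
    using finite_subset[OF 0(2)] by (simp add: cascade_sum_def)
  then show ?case by simp
next
  case (Suc d)
  define R where "R = {t \<in> N. Poly_Mapping.lookup t v = 0}"
  define C where "C = {s. s + var v \<in> N}"
  define CR where "CR = {t \<in> C. Poly_Mapping.lookup t v = 0}"
  define k1 where "k1 = (\<lambda>j. k (Suc j) - 1)"
  note tail = cascade_tail[OF Suc.prems(1), folded k1_def]
  show ?case
  proof (rule ccontr)
    assume "\<not> ?thesis"
    then have less: "cascade_down (Suc d) k < card R" by (simp add: R_def)
    have "card N = card R + card C"
      unfolding R_def C_def by (rule card_split_last) fact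
    \<comment> \<open>The strict inequality \<open>less\<close> gains the 1 that is lost in
      \<open>cascade_tail\<close>.\<close>
    then have "card C \<le> cascade_sum d k1"
      using less tail(2) Suc.prems(4) by linarith
    moreover have C: "C \<subseteq> monomials (Suc v) d"
      using Suc.prems(2) by (force simp: C_def monomials_add_var_iff)
    moreover have C_st: "strongly_stable (Suc v) C"
      unfolding strongly_stable_def
    proof (intro allI impI)
      fix s i j assume "i < j" "j < Suc v" "s + var i \<in> C"
      then show "s + var j \<in> C"
        using Suc.prems(3)[unfolded strongly_stable_def, rule_format, of i j "s + var v"]
        by (simp add: C_def ac_simps)
    qed
    ultimately have CR: "card CR \<le> cascade_down d k1"
      using Suc.IH tail(1) unfolding CR_def by blast
    obtain k2 where k2: "cascade d k2" "cascade_sum d k2 = cascade_down d k1"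
      "cascade_up d k2 = (\<Sum>j<d. k1 j choose Suc (Suc j))"
      using cascade_down_cascade[OF tail(1)] .
    \<comment> \<open>Stability exchanges \<open>var i\<close> for \<open>var v\<close>, so dividing
      an element of \<open>R\<close> by one of its variables lands in the colon.\<close>
    have "shadow_in R CR"
      unfolding shadow_in_def
    proof (intro allI impI)
      fix s i assume *: "s + var i \<in> R"
      then have "s + var i \<in> monomials (Suc v) (Suc d)" "i \<noteq> v"
        using Suc.prems(2) by (auto simp: R_def lookup_add)
      then have "i < v" by (simp add: monomials_add_var_iff)
      then have "s + var v \<in> N"
        using * Suc.prems(3)[unfolded strongly_stable_def, rule_format, of i v s]
        by (simp add: R_def)
      then show "s \<in> CR"
        using * by (simp add: CR_def C_def R_def lookup_add)
    qed
    moreover have "CR \<subseteq> monomials v d"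
      using C by (auto simp: CR_def monomials_restrict[of v d, symmetric])
    moreover have "R \<subseteq> monomials v (Suc d)"
      using Suc.prems(2) by (auto simp: R_def monomials_restrict[of v "Suc d", symmetric])
    moreover have "strongly_stable v CR" "strongly_stable v R"
      unfolding CR_def R_def using C_st Suc.prems(3) strongly_stable_restrict by blast+
    ultimately have "card R \<le> cascade_up d k2"
      using macaulay_boundD[OF M k2(1)] CR k2(2) by simp
    also have "\<dots> \<le> cascade_down (Suc d) k"
      using tail(3) by (simp add: k2(3) k1_def)
    finally show False using less by simp
  qed
qed

text \<open>Split \<open>T\<close> by divisibility by the last variable. Division sends the
  divisible part injectively into \<open>S\<close>; the rest has its shadow in the restriction of
  \<open>S\<close>, which Green's bound estimates, so induction on \<open>v\<close> applies.
  Pascal's rule (\<open>cascade_up_split\<close>) adds the two bounds.\<close>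

lemma macaulay_bound: "macaulay_bound v"
proof (induction v)
  case 0
  have "monomials 0 (Suc d) = {}" for d
    by (auto simp: monomials_def mono_deg_def)
  then show ?case by (simp add: macaulay_bound_def)
next
  case (Suc v)
  show ?case
    unfolding macaulay_bound_def
  proof (intro allI impI)
    fix d k S T
    assume *: "cascade d k" "S \<subseteq> monomials (Suc v) d" "T \<subseteq> monomials (Suc v) (Suc d)" "shadow_in T S"
      "strongly_stable (Suc v) S" "strongly_stable (Suc v) T" "card S \<le> cascade_sum d k"
    define R where "R = {t \<in> S. Poly_Mapping.lookup t v = 0}"
    define RT where "RT = {t \<in> T. Poly_Mapping.lookup t v = 0}"
    obtain k2 where k2: "cascade d k2" "cascade_sum d k2 = cascade_down d k"
      "cascade_up d k2 = (\<Sum>j<d. k j choose Suc (Suc j))"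
      using cascade_down_cascade[OF *(1)] .
    have "card R \<le> cascade_sum d k2"
      unfolding R_def k2(2) by (rule green_bound[OF Suc]) fact+
    moreover have "shadow_in RT R"
      using *(4) by (auto simp: shadow_in_def R_def RT_def lookup_add)
    moreover have "R \<subseteq> monomials v d" "RT \<subseteq> monomials v (Suc d)"
      using *(2,3) by (auto simp: R_def RT_def monomials_restrict[of v d, symmetric] monomials_restrict[of v "Suc d", symmetric])
    moreover have "strongly_stable v R" "strongly_stable v RT"
      unfolding R_def RT_def using *(5,6) strongly_stable_restrict by blast+
    ultimately have "card RT \<le> cascade_up d k2"
      using macaulay_boundD[OF Suc k2(1)] by blast
    moreover have "card {s. s + var v \<in> T} \<le> card S"
      using *(2,4) finite_subset[OF *(2)] by (intro card_mono) (auto simp: shadow_in_def)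
    moreover have "card T = card RT + card {s. s + var v \<in> T}"
      unfolding RT_def by (rule card_split_last) fact
    ultimately show "card T \<le> cascade_up d k"
      using *(7) cascade_up_split[of d k] k2(3) by linarith
  qed
qed

section \<open>Compression\<close>

text \<open>Runs through the line of monomials that share with \<open>t\<close> the total of the
  exponents at \<open>i\<close> and \<open>j\<close> and all other exponents. Since subtraction is
  truncated, this holds only for \<open>a\<close> up to that total.\<close>

definition move :: "nat \<Rightarrow> nat \<Rightarrow> mono \<Rightarrow> nat \<Rightarrow> mono" where
  "move i j t a = Poly_Mapping.update i a
     (Poly_Mapping.update j (Poly_Mapping.lookup t i + Poly_Mapping.lookup t j - a) t)"

definition fibre :: "nat \<Rightarrow> nat \<Rightarrow> mono set \<Rightarrow> mono \<Rightarrow> nat set" where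
  "fibre i j T t = {a. a \<le> Poly_Mapping.lookup t i + Poly_Mapping.lookup t j \<and> move i j t a \<in> T}"

text \<open>Replaces every fibre by the initial segment of the same size.\<close>

definition compress :: "nat \<Rightarrow> nat \<Rightarrow> mono set \<Rightarrow> mono set" where
  "compress i j T = {t. Poly_Mapping.lookup t i < card (fibre i j T t)}"

text \<open>The termination measure of compression: exchanging a variable for one of larger index
  raises it.\<close>

definition weight :: "mono \<Rightarrow> nat" where
  "weight t = (\<Sum>l\<in>Poly_Mapping.keys t. l * Poly_Mapping.lookup t l)"

section \<open>Weights, moves and fibres\<close>

lemma weight_eq:
  assumes "finite A" "Poly_Mapping.keys t \<subseteq> A"
  shows "weight t = (\<Sum>l\<in>A. l * Poly_Mapping.lookup t l)"
  unfolding weight_def using assms by (intro sum.mono_neutral_left) (auto simp: in_keys_iff)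

lemma weight_add: "weight (s + t) = weight s + weight t"
  by (simp add: weight_eq[of "Poly_Mapping.keys s \<union> Poly_Mapping.keys t"] keys_add_mono
      lookup_add sum.distrib algebra_simps)

lemma weight_single [simp]: "weight (Poly_Mapping.single i a) = i * a"
  by (simp add: weight_eq[of "{i}"])

lemma lookup_move:
  "Poly_Mapping.lookup (move i j t a) l =
     (if l = i then a
      else if l = j then Poly_Mapping.lookup t i + Poly_Mapping.lookup t j - a
      else Poly_Mapping.lookup t l)"
  by (auto simp: move_def lookup_update)

lemma move_move:
  "i \<noteq> j \<Longrightarrow> a \<le> Poly_Mapping.lookup t i + Poly_Mapping.lookup t j \<Longrightarrow>
    move i j (move i j t a) b = move i j t b"
  by (rule poly_mapping_eqI) (auto simp: lookup_move)

lemma move_self: "move i j t (Poly_Mapping.lookup t i) = t"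
  by (rule poly_mapping_eqI) (auto simp: lookup_move)

text \<open>An additive form of a move, to which \<open>mono_deg\<close> and \<open>weight\<close>
  can be applied.\<close>

lemma move_add:
  assumes "i \<noteq> j" "a \<le> Poly_Mapping.lookup t i + Poly_Mapping.lookup t j"
  shows "move i j t a + Poly_Mapping.single i (Poly_Mapping.lookup t i) +
      Poly_Mapping.single j (Poly_Mapping.lookup t j) =
    t + Poly_Mapping.single i a +
      Poly_Mapping.single j (Poly_Mapping.lookup t i + Poly_Mapping.lookup t j - a)"
  using assms by (intro poly_mapping_eqI) (auto simp: lookup_move lookup_add lookup_single when_def)

lemma move_mem_monomials:
  assumes "i \<noteq> j" "i < v" "j < v" "a \<le> Poly_Mapping.lookup t i + Poly_Mapping.lookup t j"
  shows "t \<in> monomials v d \<Longrightarrow> move i j t a \<in> monomials v d"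
  using arg_cong[OF move_add[OF assms(1,4)], of mono_deg] assms
  by (auto simp: monomials_def mono_deg_add in_keys_iff lookup_move subset_iff split: if_splits)

lemma move_mem_monomials_iff:
  assumes "i \<noteq> j" "i < v" "j < v" "a \<le> Poly_Mapping.lookup t i + Poly_Mapping.lookup t j"
  shows "move i j t a \<in> monomials v d \<longleftrightarrow> t \<in> monomials v d"
  using move_mem_monomials[OF assms]
    move_mem_monomials[OF assms(1-3), of "Poly_Mapping.lookup t i" "move i j t a" d]
  by (auto simp: move_move[OF assms(1,4)] move_self lookup_move assms assms(1)[symmetric])

lemma fibre_move:
  "i \<noteq> j \<Longrightarrow> a \<le> Poly_Mapping.lookup t i + Poly_Mapping.lookup t j \<Longrightarrow>
    fibre i j T (move i j t a) = fibre i j T t"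
  by (auto simp: fibre_def move_move lookup_move)

lemma finite_fibre [simp]: "finite (fibre i j T t)"
  by (rule finite_subset[of _ "{..Poly_Mapping.lookup t i + Poly_Mapping.lookup t j}"])
    (auto simp: fibre_def)

lemma compress_subset_monomials:
  assumes "T \<subseteq> monomials v d" "i < v" "j < v" "i \<noteq> j"
  shows "compress i j T \<subseteq> monomials v d"
proof
  fix t assume "t \<in> compress i j T"
  then have "fibre i j T t \<noteq> {}" by (auto simp: compress_def)
  then show "t \<in> monomials v d"
    using assms move_mem_monomials_iff by (fastforce simp: fibre_def)
qed

lemma bij_betw_rank:
  assumes "finite (A :: nat set)"
  shows "bij_betw (\<lambda>a. card {b \<in> A. b < a}) A {..<card A}"
proof -
  have less: "card {b \<in> A. b < a} < card {b \<in> A. b < a'}" if "a \<in> A" "a < a'" for a a'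
    using that assms by (intro psubset_card_mono) auto
  have inj: "inj_on (\<lambda>a. card {b \<in> A. b < a}) A"
  proof (rule inj_onI)
    fix a a' assume "a \<in> A" "a' \<in> A" "card {b \<in> A. b < a} = card {b \<in> A. b < a'}"
    then show "a = a'"
      using less[of a a'] less[of a' a] by (cases a a' rule: linorder_cases) auto
  qed
  have "card {b \<in> A. b < a} < card A" if "a \<in> A" for a
    using that assms by (intro psubset_card_mono) auto
  then have "(\<lambda>a. card {b \<in> A. b < a}) ` A \<subseteq> {..<card A}" by auto
  then have "(\<lambda>a. card {b \<in> A. b < a}) ` A = {..<card A}"
    by (rule card_subset_eq[OF finite_lessThan]) (simp add: card_image[OF inj])
  with inj show ?thesis by (simp add: bij_betw_def)
qed

text \<open>Sends the exponent of \<open>i\<close> to its rank in the fibre, so that the fibre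
  slides down onto an initial segment.\<close>

definition compress_map :: "nat \<Rightarrow> nat \<Rightarrow> mono set \<Rightarrow> mono \<Rightarrow> mono" where
  "compress_map i j T t =
     move i j t (card {b \<in> fibre i j T t. b < Poly_Mapping.lookup t i})"

lemma rank_le: "card {b \<in> A. b < (a::nat)} \<le> a"
  using card_mono[of "{..<a}" "{b \<in> A. b < a}"] by auto

lemma mem_fibre: "t \<in> T \<Longrightarrow> Poly_Mapping.lookup t i \<in> fibre i j T t"
  by (simp add: fibre_def move_self)

text \<open>The map stays on its line and so keeps the fibre; there it is the rank bijection of
  \<open>bij_betw_rank\<close>, and moving back recovers the monomial.\<close>

lemma bij_betw_compress_map:
  assumes "i \<noteq> j"
  shows "bij_betw (compress_map i j T) T (compress i j T)"
proof -
  let ?r = "\<lambda>t a. card {b \<in> fibre i j T t. b < a}"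
  have bound: "?r t (Poly_Mapping.lookup t i) \<le> Poly_Mapping.lookup t i + Poly_Mapping.lookup t j" for t
    using rank_le by (rule le_trans) simp
  have fib: "fibre i j T (compress_map i j T t) = fibre i j T t" for t
    unfolding compress_map_def by (rule fibre_move[OF assms bound])
  have "inj_on (compress_map i j T) T"
  proof (rule inj_onI)
    fix t u assume tu: "t \<in> T" "u \<in> T" and eq: "compress_map i j T t = compress_map i j T u"
    have f: "fibre i j T t = fibre i j T u" using fib eq by metis
    have "?r t (Poly_Mapping.lookup t i) = ?r u (Poly_Mapping.lookup u i)"
      using arg_cong[OF eq, of "\<lambda>t. Poly_Mapping.lookup t i"]
      by (simp add: compress_map_def lookup_move)
    then have "?r u (Poly_Mapping.lookup t i) = ?r u (Poly_Mapping.lookup u i)"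
      by (simp add: f)
    moreover have "Poly_Mapping.lookup t i \<in> fibre i j T u" "Poly_Mapping.lookup u i \<in> fibre i j T u"
      using mem_fibre[OF tu(1), of i j] mem_fibre[OF tu(2), of i j] by (simp_all add: f)
    moreover have "inj_on (?r u) (fibre i j T u)"
      using bij_betw_rank[OF finite_fibre] by (simp add: bij_betw_def)
    ultimately have i: "Poly_Mapping.lookup t i = Poly_Mapping.lookup u i"
      by (metis inj_onD)
    have "t = move i j (compress_map i j T t) (Poly_Mapping.lookup t i)"
      unfolding compress_map_def move_move[OF assms bound] by (simp add: move_self)
    also have "\<dots> = move i j (compress_map i j T u) (Poly_Mapping.lookup u i)"
      by (simp only: eq i)
    also have "\<dots> = u"
      unfolding compress_map_def move_move[OF assms bound] by (simp add: move_self)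
    finally show "t = u" .
  qed
  moreover have "compress_map i j T ` T = compress i j T"
  proof (intro equalityI subsetI)
    fix t assume "t \<in> compress_map i j T ` T"
    then obtain u where u: "u \<in> T" "t = compress_map i j T u" by blast
    have "?r u (Poly_Mapping.lookup u i) < card (fibre i j T u)"
      using bij_betw_apply[OF bij_betw_rank[OF finite_fibre] mem_fibre[OF u(1)]] by simp
    then show "t \<in> compress i j T"
      unfolding compress_def mem_Collect_eq u(2) fib by (simp add: compress_map_def lookup_move)
  next
    fix t assume "t \<in> compress i j T"
    then have "Poly_Mapping.lookup t i \<in> ?r t ` fibre i j T t"
      using bij_betw_rank[OF finite_fibre, of i j T t] by (simp add: bij_betw_def compress_def)
    then obtain a where a: "a \<in> fibre i j T t" "Poly_Mapping.lookup t i = ?r t a" by blast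
    from a(1) have le: "a \<le> Poly_Mapping.lookup t i + Poly_Mapping.lookup t j"
      and mem: "move i j t a \<in> T"
      by (auto simp: fibre_def)
    have "compress_map i j T (move i j t a) = t"
      unfolding compress_map_def fibre_move[OF assms le] lookup_move
      by (simp add: a(2)[symmetric] move_move[OF assms le] move_self)
    with mem show "t \<in> compress_map i j T ` T" by (metis imageI)
  qed
  ultimately show ?thesis by (simp add: bij_betw_def)
qed

lemma card_compress: "i \<noteq> j \<Longrightarrow> card (compress i j T) = card T"
  using bij_betw_same_card[OF bij_betw_compress_map, of i j T] by simp

lemma weight_compress_map:
  assumes "i < j"
  shows "weight (compress_map i j T t) = weight t +
    (j - i) * (Poly_Mapping.lookup t i - card {b \<in> fibre i j T t. b < Poly_Mapping.lookup t i})"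
proof -
  define a where "a = card {b \<in> fibre i j T t. b < Poly_Mapping.lookup t i}"
  have "a \<le> Poly_Mapping.lookup t i" unfolding a_def by (rule rank_le)
  then obtain c where c: "Poly_Mapping.lookup t i = a + c" using le_iff_add by blast
  obtain e where e: "j = i + e" using assms less_imp_add_positive by blast
  have "weight (move i j t a) + i * (a + c) + j * Poly_Mapping.lookup t j =
      weight t + i * a + j * (c + Poly_Mapping.lookup t j)"
    using arg_cong[OF move_add[of i j a t], of weight] assms c by (simp add: weight_add)
  then show ?thesis
    unfolding compress_map_def a_def[symmetric] by (simp add: c e algebra_simps)
qed

lemma sum_weight_compress:
  assumes "i < j"
  shows "sum weight (compress i j T) = (\<Sum>t\<in>T. weight (compress_map i j T t))"
  using sum.reindex_bij_betw[OF bij_betw_compress_map, of i j weight T] assms by simp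

lemma sum_weight_compress_le:
  assumes "i < j"
  shows "sum weight T \<le> sum weight (compress i j T)"
  unfolding sum_weight_compress[OF assms] by (intro sum_mono) (simp add: weight_compress_map assms)

lemma sum_weight_compress_less:
  assumes "i < j" "finite T" "s + var i \<in> T" "s + var j \<notin> T"
  shows "sum weight T < sum weight (compress i j T)"
  unfolding sum_weight_compress[OF assms(1)]
proof (rule sum_strict_mono_ex1[OF assms(2)])
  show "\<forall>t\<in>T. weight t \<le> weight (compress_map i j T t)"
    by (simp add: weight_compress_map assms)
  let ?t = "s + var i"
  have "move i j ?t (Poly_Mapping.lookup s i) = s + var j"
    using assms(1) by (intro poly_mapping_eqI) (auto simp: lookup_move lookup_add lookup_single when_def)
  \<comment> \<open>The missing \<open>s + var j\<close> is a gap in the fibre just below the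
    exponent of \<open>i\<close> in \<open>?t\<close>, so the rank is smaller than that
    exponent.\<close>
  then have "Poly_Mapping.lookup s i \<notin> fibre i j T ?t"
    using assms(4) by (simp add: fibre_def)
  then have "{b \<in> fibre i j T ?t. b < Poly_Mapping.lookup ?t i} \<subseteq> {..<Poly_Mapping.lookup s i}"
    by (auto simp: lookup_add less_Suc_eq)
  then have "card {b \<in> fibre i j T ?t. b < Poly_Mapping.lookup ?t i} \<le> Poly_Mapping.lookup s i"
    using card_mono[of "{..<Poly_Mapping.lookup s i}"] by auto
  then have "weight ?t < weight (compress_map i j T ?t)"
    unfolding weight_compress_map[OF assms(1)] using assms(1) by (simp add: lookup_add)
  then show "\<exists>t\<in>T. weight t < weight (compress_map i j T t)"
    using assms(3) by blast
qed

text \<open>Omit a point \<open>m\<close>, keep what lies below it and lower by one what lies above: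
  this is an injection into \<open>B\<close>. With \<open>m\<close> outside \<open>A\<close> nothing
  is lost; only the full interval must give up an element.\<close>

lemma card_shadow_interval:
  assumes "A \<subseteq> {..Suc D}" "finite B"
    and low: "\<And>a. a \<in> A \<Longrightarrow> 0 < a \<Longrightarrow> a - 1 \<in> B"
    and same: "\<And>a. a \<in> A \<Longrightarrow> a \<le> D \<Longrightarrow> a \<in> B"
  shows "min (card A) (Suc D) \<le> card B"
proof -
  have *: "card (A - {m}) \<le> card B" if "m \<le> Suc D" for m
  proof (rule card_inj_on_le[where f = "\<lambda>a. if a < m then a else a - 1"])
    show "inj_on (\<lambda>a. if a < m then a else a - 1) (A - {m})"
      by (auto simp: inj_on_def split: if_splits)
    show "(\<lambda>a. if a < m then a else a - 1) ` (A - {m}) \<subseteq> B"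
      using that low same by auto
  qed fact
  show ?thesis
  proof (cases "A = {..Suc D}")
    case True
    then show ?thesis using *[of 0] by simp
  next
    case False
    then obtain m where "m \<le> Suc D" "m \<notin> A" using assms(1) by auto
    then show ?thesis using *[of m] by simp
  qed
qed

lemma shadow_in_compress:
  assumes "i \<noteq> j" "shadow_in T S"
  shows "shadow_in (compress i j T) (compress i j S)"
  unfolding shadow_in_def
proof (intro allI impI)
  fix s l
  define u where "u = s + var l"
  assume "s + var l \<in> compress i j T"
  then have u: "Poly_Mapping.lookup u i < card (fibre i j T u)"
    by (simp add: compress_def u_def)
  have sh: "w \<in> S" if "x \<in> T" "x = w + var m" for x w m
    using assms(2) that unfolding shadow_in_def by blast
  let ?D = "Poly_Mapping.lookup s i + Poly_Mapping.lookup s j"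
  show "s \<in> compress i j S"
  proof (cases "l = i \<or> l = j")
    case False
    have "move i j u a = move i j s a + var l" for a
      using False by (intro poly_mapping_eqI)
        (auto simp: lookup_move lookup_add lookup_single u_def when_def)
    then have "fibre i j T u \<subseteq> fibre i j S s"
      using False sh by (auto simp: fibre_def u_def lookup_add lookup_single when_def)
    then have "card (fibre i j T u) \<le> card (fibre i j S s)"
      by (intro card_mono) auto
    then show ?thesis
      using u False by (auto simp: compress_def u_def lookup_add lookup_single when_def)
  next
    case True
    then have D: "Poly_Mapping.lookup u i + Poly_Mapping.lookup u j = Suc ?D"
      using assms(1) by (auto simp: u_def lookup_add lookup_single when_def)
    \<comment> \<open>The line through \<open>s\<close> is one shorter than the line through
      \<open>u\<close>. A point \<open>a\<close> of the latter is divisible by \<open>var i\<close>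
      if positive and by \<open>var j\<close> if at most \<open>?D\<close>.\<close>
    have "min (card (fibre i j T u)) (Suc ?D) \<le> card (fibre i j S s)"
    proof (rule card_shadow_interval)
      show "fibre i j T u \<subseteq> {..Suc ?D}"
        by (auto simp: fibre_def D)
      fix a assume a: "a \<in> fibre i j T u"
      then have aD: "a \<le> Suc ?D" "move i j u a \<in> T" by (auto simp: fibre_def D)
      {
        assume "0 < a"
        then have "move i j u a = move i j s (a - 1) + var i"
          using True D aD(1) assms(1) by (intro poly_mapping_eqI)
            (auto simp: lookup_move lookup_add lookup_single u_def when_def)
        then show "a - 1 \<in> fibre i j S s"
          using sh aD by (auto simp: fibre_def)
      }
      {
        assume "a \<le> ?D"
        then have "move i j u a = move i j s a + var j"
          using True D assms(1) by (intro poly_mapping_eqI)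
            (auto simp: lookup_move lookup_add lookup_single u_def when_def)
        then show "a \<in> fibre i j S s"
          using sh aD \<open>a \<le> ?D\<close> by (auto simp: fibre_def)
      }
    qed simp
    moreover have "Poly_Mapping.lookup s i \<le> Poly_Mapping.lookup u i"
      by (simp add: u_def lookup_add)
    ultimately show ?thesis
      using u by (simp add: compress_def)
  qed
qed

text \<open>Compressing both sets by the same pair preserves the hypotheses and strictly raises the
  total weight when one of them violates stability at that pair. The weight is bounded by that of
  all monomials, so the process ends at strongly stable sets.\<close>

theorem macaulay_bound_shadow:
  assumes "cascade d k"
  shows "S \<subseteq> monomials v d \<Longrightarrow> T \<subseteq> monomials v (Suc d) \<Longrightarrow> shadow_in T S \<Longrightarrow>
    card S \<le> cascade_sum d k \<Longrightarrow> card T \<le> cascade_up d k"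
proof (induction "sum weight (monomials v d) + sum weight (monomials v (Suc d)) -
    (sum weight S + sum weight T)" arbitrary: S T rule: less_induct)
  case less
  note fin = finite_subset[OF less.prems(1) finite_monomials] finite_subset[OF less.prems(2) finite_monomials]
  show ?case
  proof (cases "strongly_stable v S \<and> strongly_stable v T")
    case True
    then show ?thesis
      using macaulay_boundD[OF macaulay_bound assms] less.prems by blast
  next
    case False
    then obtain s i j where ij: "i < j" "j < v" and
      "s + var i \<in> S \<and> s + var j \<notin> S \<or> s + var i \<in> T \<and> s + var j \<notin> T"
      unfolding strongly_stable_def by blast
    then have "sum weight S + sum weight T <
        sum weight (compress i j S) + sum weight (compress i j T)"
      using sum_weight_compress_less[of i j _ s] sum_weight_compress_le[of i j] fin
      by (meson add_le_less_mono add_less_le_mono)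
    moreover have sub: "compress i j S \<subseteq> monomials v d" "compress i j T \<subseteq> monomials v (Suc d)"
      using compress_subset_monomials less.prems(1,2) ij by (metis less_trans less_irrefl)+
    moreover have "sum weight (compress i j S) + sum weight (compress i j T) \<le>
        sum weight (monomials v d) + sum weight (monomials v (Suc d))"
      using sub by (intro add_mono sum_mono2) auto
    moreover have "shadow_in (compress i j T) (compress i j S)"
      using shadow_in_compress[of i j T S] less.prems(3) ij by simp
    moreover have "card (compress i j S) \<le> cascade_sum d k"
      using less.prems(4) ij by (simp add: card_compress)
    ultimately have "card (compress i j T) \<le> cascade_up d k"
      using less.hyps[of "compress i j S" "compress i j T"] by linarith
    then show ?thesis using ij by (simp add: card_compress)
  qed
qed

section \<open>Standard monomials\<close>

text \<open>Indices are added in increasing order; a new value either lies in the span so far or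
  enlarges an independent family. The selected values thus form a basis, and injectivity allows
  counting indices instead of values.\<close>

lemma (in vector_space) card_greedy_basis:
  fixes f :: "'i::linorder \<Rightarrow> 'b"
  assumes "finite M"
  shows "card {t \<in> M. f t \<notin> span (f ` {u \<in> M. u < t})} = dim (f ` M)"
proof -
  define N where "N M = {t \<in> M. f t \<notin> span (f ` {u \<in> M. u < t})}" for M
  have "inj_on f (N M) \<and> independent (f ` N M) \<and> span (f ` N M) = span (f ` M)"
    using assms
  proof (induction M rule: finite_linorder_max_induct)
    case empty
    then show ?case by (simp add: N_def independent_empty)
  next
    case (insert b A)
    have eq: "{u \<in> insert b A. u < t} = {u \<in> A. u < t}" if "t \<in> A" for t
      using insert(2) that by auto
    have eqb: "{u \<in> insert b A. u < b} = A"
      using insert(2) by auto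
    have N: "N (insert b A) = (if f b \<in> span (f ` A) then N A else insert b (N A))"
      using eq eqb insert(2) by (auto simp: N_def)
    show ?case
    proof (cases "f b \<in> span (f ` A)")
      case True
      then show ?thesis using insert.IH N by (simp add: span_redundant)
    next
      case False
      then have *: "f b \<notin> span (f ` N A)" using insert.IH by simp
      then have "f b \<notin> f ` N A" using span_base by blast
      moreover have "independent (insert (f b) (f ` N A))"
        using * insert.IH by (intro independent_insertI) auto
      moreover have "span (insert (f b) (f ` N A)) = span (insert (f b) (f ` A))"
        using insert.IH by (simp add: span_insert)
      ultimately show ?thesis
        using insert.IH N False by auto
    qed
  qed
  then have inj: "inj_on f (N M)" and indep: "independent (f ` N M)"
    and span: "span (f ` N M) = span (f ` M)"
    by blast+
  have "card (N M) = dim (f ` N M)"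
    using card_image[OF inj] dim_eq_card_independent[OF indep] by simp
  also have "\<dots> = dim (f ` M)"
    by (rule span_eq_dim[OF span])
  finally show ?thesis by (simp add: N_def)
qed

lemma vector_space_fun: "vector_space (\<lambda>(c :: 'k :: field) (v :: 'i \<Rightarrow> 'k) i. c * v i)"
  by unfold_locales (auto simp: fun_eq_iff algebra_simps)

lemma dim_functions_supported:
  assumes "finite L"
  shows "vector_space.dim (\<lambda>(c :: 'k :: field) (v :: 'i \<Rightarrow> 'k) i. c * v i)
    {v. \<forall>i. v i \<noteq> 0 \<longrightarrow> i \<in> L} = card L"
proof -
  interpret vector_space "\<lambda>(c :: 'k) (v :: 'i \<Rightarrow> 'k) i. c * v i"
    by (rule vector_space_fun)
  define e where "e i = (\<lambda>j. if j = i then 1 else 0 :: 'k)" for i :: 'i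
  have sub: "subspace {v :: 'i \<Rightarrow> 'k. \<forall>i. v i \<noteq> 0 \<longrightarrow> i \<in> J}" for J
    by (auto simp: subspace_def) force
  have span_e: "span (e ` J) \<subseteq> {v. \<forall>i. v i \<noteq> 0 \<longrightarrow> i \<in> J}" for J
    by (rule span_minimal[OF _ sub]) (auto simp: e_def split: if_splits)
  have inj: "inj e"
    by (auto simp: inj_def e_def fun_eq_iff)
  have "independent (e ` L)"
    unfolding dependent_def
  proof (rule notI, elim bexE)
    fix a assume "a \<in> e ` L" "a \<in> span (e ` L - {a})"
    then obtain i where i: "e i \<in> span (e ` (L - {i}))"
      using inj by (auto simp: image_set_diff)
    then have "e i \<in> {v. \<forall>j. v j \<noteq> 0 \<longrightarrow> j \<in> L - {i}}"
      using span_e by blast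
    moreover have "e i i \<noteq> 0" by (simp add: e_def)
    ultimately show False by blast
  qed
  moreover have "{v. \<forall>i. v i \<noteq> 0 \<longrightarrow> i \<in> L} \<subseteq> span (e ` L)"
  proof
    fix v :: "'i \<Rightarrow> 'k" assume "v \<in> {v. \<forall>i. v i \<noteq> 0 \<longrightarrow> i \<in> L}"
    then have expand: "v j = (\<Sum>i\<in>L. v i * e i j)" for j
      using assms by (auto simp: e_def if_distrib cong: if_cong)
    have "(\<Sum>i\<in>L. (\<lambda>j. v i * e i j)) j = (\<Sum>i\<in>L. v i * e i j)" for j
      using assms by (induction L) auto
    then have "v = (\<Sum>i\<in>L. (\<lambda>j. v i * e i j))" by (intro ext) (rule trans[OF expand sym])
    moreover have "(\<Sum>i\<in>L. (\<lambda>j. v i * e i j)) \<in> span (e ` L)"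
      by (intro span_sum span_scale[of "e _"] span_base) auto
    ultimately show "v \<in> span (e ` L)"
      by (rule ssubst[where P = "\<lambda>x. x \<in> span (e ` L)"])
  qed
  ultimately have "card (e ` L) = dim {v :: 'i \<Rightarrow> 'k. \<forall>i. v i \<noteq> 0 \<longrightarrow> i \<in> L}"
    by (intro basis_card_eq_dim) (auto simp: e_def split: if_splits)
  then show ?thesis
    using inj by (simp add: card_image inj_on_subset)
qed

lemma poly_comp_eq: "poly_comp n (int l) = {p. Poly_Mapping.keys p \<subseteq> monomials (Suc n) l}"
  by (auto simp: poly_comp_def poly_ring_def monomials_def lessThan_Suc_atMost)

text \<open>Abstracts the projection of the polynomial ring onto a quotient with given bases:
  \<open>\<phi>\<close> is linear, its kernel is stable under the variables, and \<open>L l\<close>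
  indexes a basis of the image of degree \<open>l\<close>.\<close>

locale graded_coordinates =
  fixes n :: nat and \<phi> :: "('k::field) mpoly \<Rightarrow> nat \<Rightarrow> 'k" and L :: "nat \<Rightarrow> nat set"
  assumes add: "p \<in> carrier (poly_ring n) \<Longrightarrow> q \<in> carrier (poly_ring n) \<Longrightarrow> \<phi> (p + q) = \<phi> p + \<phi> q"
    and scale: "p \<in> carrier (poly_ring n) \<Longrightarrow> \<phi> (Poly_Mapping.single 0 c * p) = (\<lambda>i. c * \<phi> p i)"
    and ker: "p \<in> carrier (poly_ring n) \<Longrightarrow> \<phi> p = 0 \<Longrightarrow> i \<le> n \<Longrightarrow>
      \<phi> (Poly_Mapping.single (var i) 1 * p) = 0"
    and image: "\<phi> ` poly_comp n (int l) = {v. \<forall>i. v i \<noteq> 0 \<longrightarrow> i \<in> L l}"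
    and finite_L: "finite (L l)"
begin

interpretation V: vector_space "\<lambda>(c :: 'k) (v :: nat \<Rightarrow> 'k) i. c * v i"
  by (rule vector_space_fun)

definition mono_val :: "mono \<Rightarrow> nat \<Rightarrow> 'k" where
  "mono_val t = \<phi> (Poly_Mapping.single t 1)"

text \<open>The complement of the leading monomials of homogeneous kernel elements, for a linear
  order compatible with addition.\<close>

definition standard :: "nat \<Rightarrow> mono set" where
  "standard l = {t \<in> monomials (Suc n) l.
     mono_val t \<notin> V.span (mono_val ` {u \<in> monomials (Suc n) l. u < t})}"

lemma carrier_iff: "p \<in> carrier (poly_ring n) \<longleftrightarrow> (\<forall>t\<in>Poly_Mapping.keys p. Poly_Mapping.keys t \<subseteq> {..n})"
  by (simp add: poly_ring_def)

lemma keys_scale: "Poly_Mapping.keys (Poly_Mapping.single 0 c * (p :: 'k mpoly)) \<subseteq> Poly_Mapping.keys p"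
  using keys_mult[of "Poly_Mapping.single 0 c" p] by (auto split: if_splits)

lemma zero_val: "\<phi> 0 = 0"
  using add[of 0 0] by (simp add: carrier_iff)

text \<open>Turns a linear relation among monomial values into a polynomial, which can then be
  multiplied by a variable.\<close>

lemma span_mono_val:
  assumes U: "U \<subseteq> {t. Poly_Mapping.keys t \<subseteq> {..n}}"
  shows "V.span (mono_val ` U) = \<phi> ` {p. Poly_Mapping.keys p \<subseteq> U}"
proof
  have car: "p \<in> carrier (poly_ring n)" if "Poly_Mapping.keys p \<subseteq> U" for p :: "'k mpoly"
    using that U by (auto simp: carrier_iff)
  show "V.span (mono_val ` U) \<subseteq> \<phi> ` {p. Poly_Mapping.keys p \<subseteq> U}"
  proof (rule V.span_minimal)
    show "mono_val ` U \<subseteq> \<phi> ` {p. Poly_Mapping.keys p \<subseteq> U}"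
      by (auto simp: mono_val_def)
    show "V.subspace (\<phi> ` {p. Poly_Mapping.keys p \<subseteq> U})"
    proof (rule V.subspaceI)
      show "0 \<in> \<phi> ` {p. Poly_Mapping.keys p \<subseteq> U}"
        using zero_val by (intro image_eqI[of _ _ 0]) auto
      fix x assume "x \<in> \<phi> ` {p. Poly_Mapping.keys p \<subseteq> U}"
      then obtain p where p: "x = \<phi> p" "Poly_Mapping.keys p \<subseteq> U" by blast
      show "(\<lambda>i. c * x i) \<in> \<phi> ` {p. Poly_Mapping.keys p \<subseteq> U}" for c
        using scale[OF car[OF p(2)], of c] keys_scale[of c p] p
        by (intro image_eqI[of _ _ "Poly_Mapping.single 0 c * p"]) auto
      fix y assume "y \<in> \<phi> ` {p. Poly_Mapping.keys p \<subseteq> U}"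
      then obtain q where q: "y = \<phi> q" "Poly_Mapping.keys q \<subseteq> U" by blast
      show "x + y \<in> \<phi> ` {p. Poly_Mapping.keys p \<subseteq> U}"
        using add[OF car car] p q Poly_Mapping.keys_add[of p q]
        by (intro image_eqI[of _ _ "p + q"]) auto
    qed
  qed
  have sum: "\<phi> (\<Sum>t\<in>F. Poly_Mapping.single t (c t)) \<in> V.span (mono_val ` U)"
    if "finite F" "F \<subseteq> U" for F c
    using that
  proof (induction F rule: finite_induct)
    case empty
    then show ?case by (simp only: sum.empty zero_val V.span_zero)
  next
    case (insert t F)
    have t: "Poly_Mapping.single t (c t) = Poly_Mapping.single 0 (c t) * Poly_Mapping.single t (1::'k)"
      by (simp add: mult_single)
    have "\<phi> (Poly_Mapping.single t (c t)) = (\<lambda>i. c t * mono_val t i)"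
      unfolding t mono_val_def using insert.prems U
      by (intro scale) (auto simp: carrier_iff)
    moreover have "mono_val t \<in> V.span (mono_val ` U)"
      using insert.prems by (intro V.span_base) auto
    ultimately have t_span: "\<phi> (Poly_Mapping.single t (c t)) \<in> V.span (mono_val ` U)"
      using V.span_scale[of "mono_val t" _ "c t"] by simp
    have "\<phi> (\<Sum>t\<in>insert t F. Poly_Mapping.single t (c t)) =
        \<phi> (Poly_Mapping.single t (c t)) + \<phi> (\<Sum>t\<in>F. Poly_Mapping.single t (c t))"
      unfolding sum.insert[OF insert.hyps]
    proof (rule add)
      show "Poly_Mapping.single t (c t) \<in> carrier (poly_ring n)"
        using insert.prems by (intro car) auto
      have "Poly_Mapping.keys (\<Sum>t\<in>F. Poly_Mapping.single t (c t)) \<subseteq>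
          (\<Union>t\<in>F. Poly_Mapping.keys (Poly_Mapping.single t (c t)))"
        by (rule keys_sum)
      also have "\<dots> \<subseteq> U"
        using insert.prems by auto
      finally show "(\<Sum>t\<in>F. Poly_Mapping.single t (c t)) \<in> carrier (poly_ring n)"
        by (rule car)
    qed
    moreover have "\<phi> (\<Sum>t\<in>F. Poly_Mapping.single t (c t)) \<in> V.span (mono_val ` U)"
      using insert.prems by (intro insert.IH) auto
    ultimately show ?case using V.span_add[OF t_span] by (simp only:)
  qed
  show "\<phi> ` {p. Poly_Mapping.keys p \<subseteq> U} \<subseteq> V.span (mono_val ` U)"
  proof (clarify)
    fix p :: "'k mpoly" assume p: "Poly_Mapping.keys p \<subseteq> U"
    have "(\<Sum>t\<in>Poly_Mapping.keys p. Poly_Mapping.single t (Poly_Mapping.lookup p t)) = p"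
      by (rule poly_mapping_eqI) (simp add: lookup_sum lookup_single when_def in_keys_iff sum.delta)
    then show "\<phi> p \<in> V.span (mono_val ` U)"
      using sum[OF finite_keys p, of "Poly_Mapping.lookup p"] by simp
  qed
qed

lemma monomials_subset: "monomials (Suc n) l \<subseteq> {t. Poly_Mapping.keys t \<subseteq> {..n}}"
  by (auto simp: monomials_def lessThan_Suc_atMost)

lemma below_subset: "{u \<in> monomials (Suc n) l. u < t} \<subseteq> {t. Poly_Mapping.keys t \<subseteq> {..n}}"
  using monomials_subset by blast

lemma card_standard: "card (standard l) = card (L l)"
proof -
  have "card (standard l) = V.dim (mono_val ` monomials (Suc n) l)"
    unfolding standard_def by (intro V.card_greedy_basis) simp
  also have "\<dots> = V.dim (V.span (mono_val ` monomials (Suc n) l))"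
    by simp
  also have "\<dots> = card (L l)"
    unfolding span_mono_val[OF monomials_subset] poly_comp_eq[symmetric] image
    by (rule dim_functions_supported) (rule finite_L)
  finally show ?thesis .
qed

text \<open>A relation expressing \<open>s\<close> modulo the kernel through smaller monomials can be multiplied
  by a variable.\<close>

lemma shadow_in_standard: "shadow_in (standard (Suc l)) (standard l)"
  unfolding shadow_in_def
proof (intro allI impI)
  fix s i assume st: "s + var i \<in> standard (Suc l)"
  then have st': "s + var i \<in> monomials (Suc n) (Suc l)" by (simp add: standard_def)
  then have i: "i \<le> n" and s: "s \<in> monomials (Suc n) l"
    by (auto simp: monomials_add_var_iff)
  show "s \<in> standard l"
  proof (rule ccontr)
    assume "s \<notin> standard l"
    then have "mono_val s \<in> V.span (mono_val ` {u \<in> monomials (Suc n) l. u < s})"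
      using s by (simp add: standard_def)
    then have "mono_val s \<in> \<phi> ` {p. Poly_Mapping.keys p \<subseteq> {u \<in> monomials (Suc n) l. u < s}}"
      by (simp only: span_mono_val[OF below_subset])
    then obtain q where q: "mono_val s = \<phi> q"
      "Poly_Mapping.keys q \<subseteq> {u \<in> monomials (Suc n) l. u < s}" by blast
    let ?q = "Poly_Mapping.single 0 (-1) * q"
    let ?x = "Poly_Mapping.single (var i) (1::'k)"
    have car_s: "Poly_Mapping.single s (1::'k) \<in> carrier (poly_ring n)"
      and car_q: "q \<in> carrier (poly_ring n)"
      using s q(2) monomials_subset[of l] by (auto simp: carrier_iff)
    have car_q': "?q \<in> carrier (poly_ring n)"
      using car_q keys_scale[of "-1" q] by (auto simp: carrier_iff)
    have car_p: "Poly_Mapping.single s 1 + ?q \<in> carrier (poly_ring n)"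
      using car_s car_q' Poly_Mapping.keys_add[of "Poly_Mapping.single s 1" ?q]
      by (fastforce simp: carrier_iff)
    have "\<phi> (Poly_Mapping.single s 1 + ?q) = 0"
      using add[OF car_s car_q'] scale[OF car_q, of "-1"] q(1)
      by (simp add: mono_val_def fun_eq_iff)
    then have 0: "\<phi> (?x * (Poly_Mapping.single s 1 + ?q)) = 0"
      by (rule ker[OF car_p _ i])
    \<comment> \<open>Addition preserves the strict order, so the relation stays below the new
      leading monomial \<open>s + var i\<close>.\<close>
    have keys_xq: "Poly_Mapping.keys (?x * q) \<subseteq> {u \<in> monomials (Suc n) (Suc l). u < s + var i}"
    proof
      fix w assume "w \<in> Poly_Mapping.keys (?x * q)"
      then obtain u where "w = u + var i" "u \<in> Poly_Mapping.keys q"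
        using keys_mult[of ?x q] by (auto simp: add.commute)
      then show "w \<in> {u \<in> monomials (Suc n) (Suc l). u < s + var i}"
        using q(2) i by (auto simp: monomials_add_var_iff)
    qed
    then have car_xq: "?x * q \<in> carrier (poly_ring n)"
      using monomials_subset[of "Suc l"] by (fastforce simp: carrier_iff)
    have "?x * (Poly_Mapping.single s 1 + ?q) =
        Poly_Mapping.single (s + var i) 1 + Poly_Mapping.single 0 (-1) * (?x * q)"
      by (simp add: distrib_left mult_single add.commute[of s] mult.left_commute)
    moreover have "Poly_Mapping.single (s + var i) (1::'k) \<in> carrier (poly_ring n)"
      using st monomials_subset[of "Suc l"] by (auto simp: carrier_iff standard_def)
    moreover have "Poly_Mapping.single 0 (-1) * (?x * q) \<in> carrier (poly_ring n)"
      using car_xq keys_scale[of "-1" "?x * q"] by (auto simp: carrier_iff)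
    ultimately have "mono_val (s + var i) + (\<lambda>j. - 1 * \<phi> (?x * q) j) = 0"
      using 0 by (simp add: add scale[OF car_xq] mono_val_def)
    then have "mono_val (s + var i) = \<phi> (?x * q)"
      by (simp add: fun_eq_iff)
    then have "mono_val (s + var i) \<in>
        \<phi> ` {p. Poly_Mapping.keys p \<subseteq> {u \<in> monomials (Suc n) (Suc l). u < s + var i}}"
      using keys_xq by blast
    then have "mono_val (s + var i) \<in>
        V.span (mono_val ` {u \<in> monomials (Suc n) (Suc l). u < s + var i})"
      by (simp only: span_mono_val[OF below_subset])
    then show False using st by (simp add: standard_def)
  qed
qed

theorem zero_sequence_card: "zero_sequence (\<lambda>l. card (L l))"
  unfolding zero_sequence_def
proof (intro allI impI)
  fix l :: nat assume "1 \<le> l"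
  then obtain k where k: "cascade l k" "cascade_sum l k = card (L l)"
    using cascade_sum_surj by metis
  have "card (standard (Suc l)) \<le> cascade_up l k"
    by (rule macaulay_bound_shadow[OF k(1) _ _ shadow_in_standard, where v = "Suc n"])
      (auto simp: standard_def[of l] standard_def[of "Suc l"] k(2) card_standard[of l, unfolded standard_def])
  then show "card (L (Suc l)) \<le> macaulay_up l (card (L l))"
    using macaulay_up_cascade_sum[OF k(1)] by (simp add: k(2) card_standard)
qed

end

section \<open>Reduction of the coordinate ring\<close>

lemma mono_add_eq_0_iff: "0 = s + t \<longleftrightarrow> s = 0 \<and> t = (0 :: mono)"
proof
  assume *: "0 = s + t"
  have "Poly_Mapping.lookup s i = 0 \<and> Poly_Mapping.lookup t i = 0" for i
    using arg_cong[OF *, of "\<lambda>u. Poly_Mapping.lookup u i"] by (simp add: lookup_add)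
  then show "s = 0 \<and> t = 0" by (auto intro: poly_mapping_eqI)
qed simp

text \<open>The zero exponent splits only as \<open>0 + 0\<close>, so a single term of the
  convolution survives.\<close>

lemma lookup_mult_0:
  fixes p q :: "'k::field mpoly"
  shows "Poly_Mapping.lookup (p * q) 0 = Poly_Mapping.lookup p 0 * Poly_Mapping.lookup q 0"
proof -
  have *: "(Poly_Mapping.lookup q b when 0 = a + b) = ((Poly_Mapping.lookup q 0 when a = 0) when b = 0)" for a b :: mono
    by (auto simp: when_def mono_add_eq_0_iff)
  have **: "Poly_Mapping.lookup p a * (Poly_Mapping.lookup q 0 when a = 0) =
      (Poly_Mapping.lookup p 0 * Poly_Mapping.lookup q 0 when a = 0)" for a
    by (auto simp: when_def)
  show ?thesis unfolding lookup_mult * Sum_any_when_equal ** ..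
qed

lemma poly_ring_simps [simp]:
  "(\<otimes>\<^bsub>poly_ring n\<^esub>) = (*)" "\<one>\<^bsub>poly_ring n\<^esub> = 1" "\<zero>\<^bsub>poly_ring n\<^esub> = 0"
  "(\<oplus>\<^bsub>poly_ring n\<^esub>) = (+)"
  by (simp_all add: poly_ring_def)

lemma poly_comp_subset: "poly_comp n l \<subseteq> carrier (poly_ring n)"
  by (auto simp: poly_comp_def)

text \<open>The coordinates of a graded free module over \<open>R\<close>, read modulo the polynomials of \<open>R\<close> without
  constant term. The kernel is stable under multiplication because multiplication by a
  polynomial is \<open>R\<close>-linear.\<close>

lemma graded_coordinates_free:
  fixes g :: "('k::field) mpoly \<Rightarrow> nat \<Rightarrow> 'k mpoly" and ms :: "nat \<Rightarrow> nat"
  assumes ring: "ring (poly_ring n :: 'k mpoly ring)"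
    and R: "constants \<subseteq> R" "R \<subseteq> carrier (poly_ring n)"
    and g_add: "\<And>p q. p \<in> carrier (poly_ring n) \<Longrightarrow> q \<in> carrier (poly_ring n) \<Longrightarrow>
      g (p + q) = (\<lambda>i\<in>{..<d}. g p i + g q i)"
    and g_smult: "\<And>r p. r \<in> R \<Longrightarrow> p \<in> carrier (poly_ring n) \<Longrightarrow>
      g (r * p) = (\<lambda>i\<in>{..<d}. r * g p i)"
    and g_image: "g ` carrier (poly_ring n) = {..<d} \<rightarrow>\<^sub>E R"
    and g_comp: "\<And>l. g ` poly_comp n l = (\<Pi>\<^sub>E i\<in>{..<d}. R \<inter> poly_comp n (l - int (ms i)))"
    and g_cong: "\<And>x p q. x \<in> carrier (poly_ring n) \<Longrightarrow> p \<in> carrier (poly_ring n) \<Longrightarrow>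
      q \<in> carrier (poly_ring n) \<Longrightarrow> g p = g q \<Longrightarrow> g (x * p) = g (x * q)"
  shows "graded_coordinates n (\<lambda>p i. if i < d then Poly_Mapping.lookup (g p i) 0 else 0)
    (\<lambda>l. {j. j < d \<and> ms j = l})"
proof -
  interpret A: ring "poly_ring n :: 'k mpoly ring" by (rule ring)
  define A where "A = carrier (poly_ring n :: 'k mpoly ring)"
  define \<phi> where "\<phi> = (\<lambda>p i. if i < d then Poly_Mapping.lookup (g p i) 0 else 0)"
  have A_mult: "p * q \<in> A" and A_add: "p + q \<in> A" if "p \<in> A" "q \<in> A" for p q
    using A.m_closed[of p q] A.a_closed[of p q] that by (simp_all add: A_def)
  have A_0: "0 \<in> A" using A.zero_closed by (simp add: A_def)
  have A_sum: "(\<Sum>j\<in>F. h j) \<in> A" if "finite F" "\<And>j. j \<in> F \<Longrightarrow> h j \<in> A" for F h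
    using that by (induction F rule: finite_induct) (auto intro: A_add A_0)
  have A_smult: "r * p \<in> A" if "r \<in> R" "p \<in> A" for r p
    using that R(2) A_mult by (auto simp: A_def)
  have const: "Poly_Mapping.single 0 c \<in> R" for c :: 'k
    using R(1) by (auto simp: constants_def)
  have R_0: "0 \<in> R" and R_1: "1 \<in> R"
    using const[of 0] const[of 1] by (simp_all add: single_one)
  have g_0: "g 0 = (\<lambda>i\<in>{..<d}. 0)"
    using g_smult[OF R_0, of 0] A_0 by (simp add: A_def)
  have \<phi>_0: "\<phi> 0 = 0"
    by (auto simp: \<phi>_def g_0)
  have \<phi>_add: "\<phi> (p + q) = \<phi> p + \<phi> q" if "p \<in> A" "q \<in> A" for p q
    using g_add[of p q] that by (auto simp: \<phi>_def A_def lookup_add fun_eq_iff)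
  have \<phi>_smult: "\<phi> (r * p) = (\<lambda>i. Poly_Mapping.lookup r 0 * \<phi> p i)" if "r \<in> R" "p \<in> A" for r p
    using g_smult[of r p] that by (auto simp: \<phi>_def A_def lookup_mult_0 fun_eq_iff)
  \<comment> \<open>Preimages of the unit vectors, that is, representatives of a basis over
    \<open>R\<close>.\<close>
  have "\<exists>e\<in>A. g e = (\<lambda>i\<in>{..<d}. if i = j then 1 else 0)" for j
  proof -
    have "(\<lambda>i\<in>{..<d}. if i = j then 1 else 0) \<in> {..<d} \<rightarrow>\<^sub>E R"
      using R_0 R_1 by auto
    then have "(\<lambda>i\<in>{..<d}. if i = j then 1 else 0) \<in> g ` A"
      by (simp only: g_image A_def)
    then show ?thesis by (elim imageE) (rule bexI, rule sym)
  qed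
  then have "\<forall>j. \<exists>e. e \<in> A \<and> g e = (\<lambda>i\<in>{..<d}. if i = j then 1 else 0)" by blast
  from choice[OF this] obtain e where
    e: "\<And>j. e j \<in> A" "\<And>j. g (e j) = (\<lambda>i\<in>{..<d}. if i = j then 1 else 0)"
    by blast
  have g_expand: "g (\<Sum>j\<in>F. r j * e j) = (\<lambda>i\<in>{..<d}. if i \<in> F then r i else 0)"
    if "finite F" "F \<subseteq> {..<d}" "\<And>j. j \<in> F \<Longrightarrow> r j \<in> R" for F r
    using that
  proof (induction F rule: finite_induct)
    case empty
    then show ?case by (simp add: g_0)
  next
    case (insert a F)
    have "g (\<Sum>j\<in>insert a F. r j * e j) = g (r a * e a + (\<Sum>j\<in>F. r j * e j))"
      using insert.hyps by simp
    also have "\<dots> = (\<lambda>i\<in>{..<d}. g (r a * e a) i + g (\<Sum>j\<in>F. r j * e j) i)"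
      using insert.prems insert.hyps e(1)
      by (intro g_add; fold A_def; intro A_smult A_sum) auto
    also have "\<dots> = (\<lambda>i\<in>{..<d}. if i \<in> insert a F then r i else 0)"
      using insert g_smult[OF insert.prems(2), of a "e a"] e(1)[of a]
      by (auto simp: A_def e(2) fun_eq_iff)
    finally show ?case .
  qed
  have ker: "\<phi> (x * p) = 0" if x: "x \<in> A" and p: "p \<in> A" "\<phi> p = 0" for x p
  proof -
    have gp: "g p \<in> {..<d} \<rightarrow>\<^sub>E R"
      using p(1) g_image by (auto simp: A_def)
    then have gpR: "g p j \<in> R" if "j < d" for j using that by auto
    have "g (\<Sum>j\<in>{..<d}. g p j * e j) = (\<lambda>i\<in>{..<d}. if i \<in> {..<d} then g p i else 0)"
      by (rule g_expand) (auto intro: gpR)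
    also have "\<dots> = g p" using gp by (auto simp: fun_eq_iff PiE_iff extensional_def)
    finally have eq: "g (\<Sum>j\<in>{..<d}. g p j * e j) = g p" .
    have "(\<Sum>j\<in>{..<d}. g p j * e j) \<in> A"
      using gpR e(1) by (intro A_sum A_smult) auto
    \<comment> \<open>By \<open>g_cong\<close>, \<open>p\<close> may be replaced by its expansion in
      the \<open>e j\<close>. Then \<open>x\<close> can be absorbed into the \<open>e j\<close>,
      while the coefficients \<open>g p j\<close> have constant term zero.\<close>
    then have "g (x * p) = g (x * (\<Sum>j\<in>{..<d}. g p j * e j))"
      using g_cong[OF _ _ _ eq[symmetric], of x] x p(1) by (simp add: A_def)
    then have "\<phi> (x * p) = \<phi> (x * (\<Sum>j\<in>{..<d}. g p j * e j))"
      by (simp only: \<phi>_def)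
    also have "x * (\<Sum>j\<in>{..<d}. g p j * e j) = (\<Sum>j\<in>{..<d}. g p j * (x * e j))"
      by (simp add: sum_distrib_left mult.left_commute)
    also have "\<phi> (\<Sum>j\<in>{..<d}. g p j * (x * e j)) = 0"
    proof -
      have "\<phi> (\<Sum>j\<in>F. g p j * (x * e j)) = 0" if "finite F" "F \<subseteq> {..<d}" for F
        using that
      proof (induction F rule: finite_induct)
        case (insert a F)
        then have "a < d" by simp
        have "Poly_Mapping.lookup (g p a) 0 = \<phi> p a"
          using \<open>a < d\<close> by (simp add: \<phi>_def)
        then have "\<phi> (g p a * (x * e a)) = 0"
          using \<phi>_smult[OF gpR[OF \<open>a < d\<close>] A_mult[OF x e(1)]] by (simp add: p(2) zero_fun_def)
        moreover have "\<phi> (\<Sum>j\<in>insert a F. g p j * (x * e j)) =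
            \<phi> (g p a * (x * e a)) + \<phi> (\<Sum>j\<in>F. g p j * (x * e j))"
          unfolding sum.insert[OF insert.hyps] using insert.prems insert.hyps x e(1)
          by (intro \<phi>_add A_sum A_smult A_mult gpR) auto
        ultimately show ?case using insert by simp
      qed (simp add: \<phi>_0)
      then show ?thesis by simp
    qed
    finally show ?thesis .
  qed
  have image: "\<phi> ` poly_comp n (int l) = {v. \<forall>i. v i \<noteq> 0 \<longrightarrow> i \<in> {j. j < d \<and> ms j = l}}" for l
  proof (intro equalityI subsetI)
    fix v assume "v \<in> \<phi> ` poly_comp n (int l)"
    then obtain p where p: "p \<in> poly_comp n (int l)" "v = \<phi> p" by blast
    have gp: "g p i \<in> poly_comp n (int l - int (ms i))" if "i < d" for i
      using imageI[OF p(1), of g] that unfolding g_comp by auto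
    have "i < d \<and> ms i = l" if "v i \<noteq> 0" for i
    proof -
      \<comment> \<open>The monomial of degree 0 occurs in a polynomial of degree
        \<open>l - ms i\<close>, which forces \<open>ms i = l\<close>.\<close>
      have "i < d" "0 \<in> Poly_Mapping.keys (g p i)"
        using that p(2) by (auto simp: \<phi>_def in_keys_iff split: if_splits)
      then show ?thesis using gp[of i] by (auto simp: poly_comp_def mono_deg_def)
    qed
    then show "v \<in> {v. \<forall>i. v i \<noteq> 0 \<longrightarrow> i \<in> {j. j < d \<and> ms j = l}}" by blast
  next
    fix v :: "nat \<Rightarrow> 'k" assume "v \<in> {v. \<forall>i. v i \<noteq> 0 \<longrightarrow> i \<in> {j. j < d \<and> ms j = l}}"
    then have v: "i < d \<and> ms i = l" if "v i \<noteq> 0" for i using that by blast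
    \<comment> \<open>If \<open>ms i\<close> differs from \<open>l\<close>, then
      \<open>v i = 0\<close>, and the zero polynomial lies in every component.\<close>
    have "Poly_Mapping.single 0 (v i) \<in> poly_comp n (int l - int (ms i))" for i
      using v[of i] by (auto simp: poly_comp_def poly_ring_def mono_deg_def)
    then have "(\<lambda>i\<in>{..<d}. Poly_Mapping.single 0 (v i)) \<in> g ` poly_comp n (int l)"
      unfolding g_comp using const by auto
    then obtain p where p: "p \<in> poly_comp n (int l)" "g p = (\<lambda>i\<in>{..<d}. Poly_Mapping.single 0 (v i))"
      by force
    have "v = \<phi> p"
      using v by (auto simp: \<phi>_def p(2) fun_eq_iff)
    then show "v \<in> \<phi> ` poly_comp n (int l)" using p(1) by blast
  qed
  have "graded_coordinates n \<phi> (\<lambda>l. {j. j < d \<and> ms j = l})"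
  proof
    show "\<phi> (p + q) = \<phi> p + \<phi> q"
      if "p \<in> carrier (poly_ring n)" "q \<in> carrier (poly_ring n)" for p q
      using that \<phi>_add by (simp add: A_def)
    show "\<phi> (Poly_Mapping.single 0 c * p) = (\<lambda>i. c * \<phi> p i)" if "p \<in> carrier (poly_ring n)" for p c
      using that \<phi>_smult[OF const, of p c] by (simp add: A_def)
    show "\<phi> (Poly_Mapping.single (var i) 1 * p) = 0"
      if "p \<in> carrier (poly_ring n)" "\<phi> p = 0" "i \<le> n" for p i
      using that by (intro ker) (auto simp: A_def poly_ring_def)
    show "\<phi> ` poly_comp n (int l) = {v. \<forall>i. v i \<noteq> 0 \<longrightarrow> i \<in> {j. j < d \<and> ms j = l}}" for l
      by (rule image)
  qed auto
  then show ?thesis unfolding \<phi>_def .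
qed

theorem mainTheorem2:
  fixes n m d :: nat
    and I :: "('k :: {alg_closed_field, field_char_0}) mpoly set"
    and ms :: "nat \<Rightarrow> nat"
  assumes "projective_subscheme n I"
    and "arith_CM n I"
    and "pure_dim n I m"
    and "has_degree n I d"
    and "characteristic_sequence n I m d ms"
  shows "zero_sequence (\<lambda>i. card {j. j < d \<and> ms j = i})"
proof -
  obtain Ys f where Ys: "set Ys \<subseteq> poly_comp n 1"
    and iso: "graded_iso (param_ring n Ys)
          (direct_sum {..<d} (\<lambda>i. shift (- int (ms i)) (param_module n Ys)))
          (coord_module n I) f"
    using assms(5) unfolding characteristic_sequence_def by blast
  interpret ideal I "poly_ring n"
    using assms(1) by (simp add: projective_subscheme_def homogeneous_ideal_def)
  define A where "A = carrier (poly_ring n :: 'k mpoly ring)"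
  define R where "R = carrier (param_ring n Ys)"
  define res where "res = residue_class n I"
  define Q where "Q = coord_ring n I"
  have const_A: "constants \<subseteq> A"
    by (auto simp: constants_def A_def poly_ring_def split: if_splits)
  have gens: "constants \<union> set Ys \<subseteq> carrier (poly_ring n)"
    using const_A subset_trans[OF Ys poly_comp_subset] by (auto simp: A_def)
  have R_eq: "R = generate_ring (poly_ring n) (constants \<union> set Ys)"
    by (simp add: R_def param_ring_def)
  have R: "constants \<subseteq> R" "R \<subseteq> A"
    using generate_ring_incl[OF gens] by (auto simp: R_eq A_def intro: generate_ring.incl)
  have R_closed: "p * q \<in> R" "p + q \<in> R" if "p \<in> R" "q \<in> R" for p q
    using that generate_ring.eng_mult[of p "poly_ring n" "constants \<union> set Ys" q]
      generate_ring.eng_add[of p "poly_ring n" "constants \<union> set Ys" q] by (simp_all add: R_eq)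
  have hom: "res \<in> ring_hom (poly_ring n) Q"
    using rcos_ring_hom by (simp add: res_def Q_def coord_ring_def residue_class_def[abs_def])
  have res_mult: "res (p * q) = res p \<otimes>\<^bsub>Q\<^esub> res q" and res_add: "res (p + q) = res p \<oplus>\<^bsub>Q\<^esub> res q"
    if "p \<in> A" "q \<in> A" for p q
    using ring_hom_mult[OF hom, of p q] ring_hom_add[OF hom, of p q] that by (simp_all add: A_def)
  have carrier_Q: "carrier Q = res ` A"
    by (auto simp: Q_def res_def A_def coord_ring_def residue_class_def FactRing_def A_RCOSETS_def')
  define D where "D = {..<d} \<rightarrow>\<^sub>E R"
  \<comment> \<open>The shift by \<open>- int (ms i)\<close> places the \<open>i\<close>-th
    generator in degree \<open>ms i\<close>.\<close>
  have bij: "bij_betw f D (carrier Q)"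
    and f_add: "\<And>x y. x \<in> D \<Longrightarrow> y \<in> D \<Longrightarrow> f (\<lambda>i\<in>{..<d}. x i + y i) = f x \<oplus>\<^bsub>Q\<^esub> f y"
    and f_smult: "\<And>r x. r \<in> R \<Longrightarrow> x \<in> D \<Longrightarrow> f (\<lambda>i\<in>{..<d}. r * x i) = res r \<otimes>\<^bsub>Q\<^esub> f x"
    and f_grade: "\<And>l. f ` (\<Pi>\<^sub>E i\<in>{..<d}. R \<inter> poly_comp n (- int (ms i) + l)) = res ` poly_comp n l"
    using iso by (simp_all add: graded_iso_def direct_sum_def shift_def param_module_def
        coord_module_def coord_comp_def D_def R_def Q_def res_def)
  \<comment> \<open>The coordinates over \<open>R\<close> of the residue class of \<open>p\<close>,
    read off through the inverse of \<open>f\<close>.\<close>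
  define g where "g p = inv_into D f (res p)" for p
  have g_D: "g p \<in> D" and f_g: "f (g p) = res p" if "p \<in> A" for p
  proof -
    have "res p \<in> f ` D" using bij that by (simp add: bij_betw_def carrier_Q)
    then show "g p \<in> D" "f (g p) = res p"
      unfolding g_def by (rule inv_into_into, rule f_inv_into_f)
  qed
  have g_eq: "g p = v" if "v \<in> D" "f v = res p" for p v
    unfolding g_def that(2)[symmetric] by (rule bij_betw_inv_into_left[OF bij that(1)])
  have "graded_coordinates n (\<lambda>p i. if i < d then Poly_Mapping.lookup (g p i) 0 else 0)
    (\<lambda>l. {j. j < d \<and> ms j = l})"
  proof (rule graded_coordinates_free[where R = R]; (fold A_def)?)
    show "ring (poly_ring n :: 'k mpoly ring)" by (rule ring_axioms)
    show "constants \<subseteq> R" "R \<subseteq> A" by fact+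
    show "g (p + q) = (\<lambda>i\<in>{..<d}. g p i + g q i)" if "p \<in> A" "q \<in> A" for p q
    proof (rule g_eq)
      show "(\<lambda>i\<in>{..<d}. g p i + g q i) \<in> D"
        using g_D[OF that(1)] g_D[OF that(2)] by (auto simp: D_def PiE_iff intro: R_closed)
      show "f (\<lambda>i\<in>{..<d}. g p i + g q i) = res (p + q)"
        using that by (simp add: f_add g_D f_g res_add)
    qed
    show "g (r * p) = (\<lambda>i\<in>{..<d}. r * g p i)" if "r \<in> R" "p \<in> A" for r p
    proof (rule g_eq)
      show "(\<lambda>i\<in>{..<d}. r * g p i) \<in> D"
        using that(1) g_D[OF that(2)] by (auto simp: D_def PiE_iff intro: R_closed)
      show "f (\<lambda>i\<in>{..<d}. r * g p i) = res (r * p)"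
        using that R(2) by (simp add: f_smult g_D f_g res_mult subsetD)
    qed
    show "g ` A = {..<d} \<rightarrow>\<^sub>E R"
    proof (fold D_def, intro equalityI subsetI)
      fix v assume v: "v \<in> D"
      then have "f v \<in> res ` A" using bij by (auto simp: bij_betw_def carrier_Q)
      then show "v \<in> g ` A" using g_eq[OF v] by (metis imageE imageI)
    qed (auto intro: g_D)
    show "g ` poly_comp n l = (\<Pi>\<^sub>E i\<in>{..<d}. R \<inter> poly_comp n (l - int (ms i)))" for l
    proof -
      let ?G = "\<Pi>\<^sub>E i\<in>{..<d}. R \<inter> poly_comp n (- int (ms i) + l)"
      have sub: "?G \<subseteq> D" by (auto simp: D_def)
      have "g ` poly_comp n l = inv_into D f ` (res ` poly_comp n l)"
        by (simp add: g_def image_image)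
      also have "\<dots> = ?G"
        unfolding f_grade[symmetric] using bij sub
        by (intro inv_into_image_cancel) (auto simp: bij_betw_def)
      finally show ?thesis by (simp add: algebra_simps)
    qed
    \<comment> \<open>Equal coordinates mean equal residue classes, and these are compatible with
      multiplication.\<close>
    show "g (x * p) = g (x * q)" if "x \<in> A" "p \<in> A" "q \<in> A" "g p = g q" for x p q
    proof -
      have "res p = res q" using that f_g by metis
      then have "res (x * p) = res (x * q)" using that by (simp add: res_mult)
      then show ?thesis by (simp add: g_def)
    qed
  qed
  then show ?thesis by (rule graded_coordinates.zero_sequence_card)
qed

end
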